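(* Let $k$ be a finite field of odd characteristic, $F = k(t)$, and $\mathcal{O} = k[t]$. Let $n \geq 3$, let $m \in \mathcal{O}$ have odd degree, let $f_0(x) = x^2 + m$, put $\gamma = m^{2^{n-1}} - f_0^n(0)$, and let $f(x) = (x-\gamma)^2 + \gamma + m$. Then $f^n$ is irreducible over $F$, and $\overline{f^n} \in (\mathcal{O}/\mathfrak{p})[x]$ is reducible for all primes $\mathfrak{p} \subset \mathcal{O}$.
   Context: For a polynomial $g$ in the variable $x$, $g^n$ denotes its $n$-th iterate (the $n$-fold composition), not its $n$-th power; $f_0^n(0)$ is the value at $0$ of the $n$-th iterate of $f_0$. By contrast $m^{2^{n-1}}$ is an ordinary power of the element $m \in k[t]$. $\overline{g}$ denotes coefficient-wise reduction of $g \in \mathcal{O}[x]$ modulo a nonzero prime ideal $\mathfrak{p}$ of $\mathcal{O}$. *)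

theory Defs
  imports
    "HOL-Computational_Algebra.Computational_Algebra"
    "HOL-Algebra.UnivPoly"
    "HOL-Algebra.QuotRing"
    "HOL-Algebra.Ring_Divisibility"
    "HOL-Algebra.Algebraic_Closure_Type"
begin

text \<open>
  The ring \<open>k[t]\<close> is the type \<open>'a poly\<close>, its fraction field \<open>k(t)\<close> is \<open>'a poly fract\<close>, and
  \<open>k[t][x]\<close> is \<open>'a poly poly\<close>. The rings \<open>k[t]/\<pp>\<close> and \<open>(k[t]/\<pp>)[x]\<close> depend on the ideal \<open>\<pp>\<close>
  and hence are \<open>HOL-Algebra\<close> structures, built from \<^const>\<open>ring_of_type_algebra\<close>.
\<close>

definition iterate_poly :: "'a::comm_semiring_1 poly \<Rightarrow> nat \<Rightarrow> 'a poly" where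
  "iterate_poly g n = (pcompose g ^^ n) [:0, 1:]"

text \<open>
  Elements of \<^term>\<open>UP R\<close> are coefficient functions, and elements of a quotient ring are cosets.
\<close>

definition reduce_poly :: "'a::comm_ring_1 set \<Rightarrow> 'a poly \<Rightarrow> nat \<Rightarrow> 'a set" where
  "reduce_poly P g = (\<lambda>i. P +>\<^bsub>ring_of_type_algebra\<^esub> Polynomial.coeff g i)"

definition ring_reducible :: "('a, 'b) ring_scheme \<Rightarrow> 'a \<Rightarrow> bool" where
  "ring_reducible R a \<longleftrightarrow>
     a \<in> carrier R \<and> a \<noteq> \<zero>\<^bsub>R\<^esub> \<and> a \<notin> Units R \<and> \<not> ring_irreducible\<^bsub>R\<^esub> a"

end

theory Submission
  imports Defs
begin

text \<open>
  Put \<open>\<phi>(y) = y\<^sup>2 + m\<close> and \<open>Q\<^sub>j(y) = \<phi>\<^sup>j(y) + \<gamma>\<close>, where \<open>\<phi>\<^sup>j\<close> is the \<open>j\<close>-th iterate. As \<open>f\<close> is the conjugate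
  of \<open>\<phi>\<close> by the translation by \<open>\<gamma>\<close>, we have \<open>f\<^sup>n(x) = Q\<^sub>n(x - \<gamma>)\<close>, and both claims are about
  \<open>Q\<^sub>n\<close>. The choice of \<open>\<gamma>\<close> makes \<open>Q\<^sub>n(0)\<close> equal to the square \<open>m^(2^(n-1))\<close>.

  \<^bold>\<open>Reducibility modulo every prime.\<close> Over a finite field of odd characteristic an even monic
  polynomial \<open>G\<close> whose degree is \<open>2 * d\<close> with \<open>d\<close> even, and whose constant term is a square
  \<open>c\<^sup>2\<close>, is never irreducible (\<open>even_poly_splits\<close>). If it were, its roots would form a single
  Frobenius orbit of length \<open>2 * d\<close>. Negation permutes the roots and commutes with Frobenius, so it
  has to be the shift by half a period, and the product \<open>\<delta>\<close> over half of the orbit is negated by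
  Frobenius. But \<open>\<delta>\<^sup>2 = G(0) = c\<^sup>2\<close>, so \<open>\<delta> = \<plusminus>c\<close> is also fixed by Frobenius, which is impossible
  because \<open>\<delta>\<close> is nonzero and the characteristic is odd. The residue field \<open>k[t]/P\<close> is realised as the subfield \<open>k(\<theta>)\<close> of the algebraic closure of
  \<open>k\<close>, where \<open>\<theta>\<close> is a root of a generator of \<open>P\<close>; the factors found there are lifted to
  \<open>k[t][x]\<close> and then reduced to polynomials over \<open>k[t]/P\<close>.

  \<^bold>\<open>Irreducibility over \<open>k(t)\<close>.\<close> If \<open>Q\<^sub>j\<close> is irreducible and \<open>Q\<^sub>j\<^sub>+\<^sub>1 = Q\<^sub>j(y\<^sup>2 + m)\<close> is not, then
  \<open>Q\<^sub>j\<^sub>+\<^sub>1 = \<plusminus>h(y) h(-y)\<close> for some monic \<open>h\<close> (\<open>reducible_pcompose_quadratic\<close>). In particular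
  \<open>\<plusminus>Q\<^sub>j\<^sub>+\<^sub>1(0)\<close> is a square. This is impossible for \<open>j + 1 < n\<close>, because then \<open>Q\<^sub>j\<^sub>+\<^sub>1(0)\<close> has the
  odd degree \<open>(2^(n-1) - 1) * deg m\<close>. So \<open>Q\<^sub>n\<^sub>-\<^sub>1\<close> is irreducible. For \<open>Q\<^sub>n\<close> the constant
  term is a square, and a local argument takes over. Since \<open>m\<close> has odd degree, it has odd order \<open>e\<close>
  at some root in the algebraic closure of \<open>k\<close>. With \<open>N = 2^(n-1)\<close>, the first segment of the Newton polygon of
  \<open>Q\<^sub>n\<close> for this order, counted from the leading term, has horizontal length \<open>N\<close> and height
  \<open>e\<close>. The polynomials \<open>h(y)\<close> and \<open>h(-y)\<close> have the same Newton polygon, so each of them would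
  contribute half of that segment, with the non-integral height \<open>e/2\<close>
  (\<open>twisted_square_newton_polygon\<close>).
\<close>

section \<open>Ring homomorphisms and iterates of polynomials\<close>

locale unital_ring_hom =
  fixes h :: "'r::comm_ring_1 \<Rightarrow> 's::comm_ring_1"
  assumes add: "h (x + y) = h x + h y"
    and mult: "h (x * y) = h x * h y"
    and one: "h 1 = 1"
begin

lemma zero [simp]: "h 0 = 0"
  using add[of 0 0] by simp

lemma uminus: "h (- x) = - h x"
  using add[of x "- x"] by (simp add: eq_neg_iff_add_eq_0 add.commute)

lemma diff: "h (x - y) = h x - h y"
  using add[of x "- y"] by (simp add: uminus)

lemma power: "h (x ^ n) = h x ^ n"
  by (induction n) (simp_all add: one mult)

lemma sum: "h (sum g S) = (\<Sum>i\<in>S. h (g i))"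
  by (induction S rule: infinite_finite_induct) (simp_all add: add)

lemma prod: "h (prod g S) = (\<Prod>i\<in>S. h (g i))"
  by (induction S rule: infinite_finite_induct) (simp_all add: one mult)

lemma map_poly_add: "map_poly h (p + q) = map_poly h p + map_poly h q"
  by (intro poly_eqI) (simp add: coeff_map_poly add)

lemma map_poly_mult: "map_poly h (p * q) = map_poly h p * map_poly h q"
  by (intro poly_eqI) (simp add: coeff_map_poly coeff_mult sum mult)

lemma map_poly_pCons': "map_poly h (pCons a p) = pCons (h a) (map_poly h p)"
  by (rule map_poly_pCons) simp

lemma map_poly_const: "map_poly h [:a:] = [:h a:]"
  by (simp add: map_poly_pCons')

lemma map_poly_hom: "unital_ring_hom (map_poly h)"
  by unfold_locales (simp_all add: map_poly_add map_poly_mult one)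

lemma poly_map_poly: "poly (map_poly h p) (h x) = h (poly p x)"
  by (induction p) (simp_all add: map_poly_pCons' add mult)

lemma map_poly_pcompose: "map_poly h (pcompose p q) = pcompose (map_poly h p) (map_poly h q)"
  by (induction p)
    (simp_all add: pcompose_pCons map_poly_add map_poly_mult map_poly_pCons')

lemma map_poly_iterate_poly: "map_poly h (iterate_poly g n) = iterate_poly (map_poly h g) n"
  by (induction n) (simp_all add: iterate_poly_def map_poly_pcompose map_poly_pCons' one)

end

lemma iterate_poly_0 [simp]: "iterate_poly g 0 = [:0, 1:]"
  by (simp add: iterate_poly_def)

lemma iterate_poly_Suc: "iterate_poly g (Suc n) = pcompose g (iterate_poly g n)"
  by (simp add: iterate_poly_def)

text \<open>
  The definition of \<open>iterate_poly\<close> puts the new copy of \<open>g\<close> on the outside. Passing from the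
  factors of one iterate to those of the next needs it on the inside.
\<close>

lemma iterate_poly_Suc2:
  fixes g :: "'r::comm_ring_1 poly"
  shows "iterate_poly g (Suc n) = pcompose (iterate_poly g n) g"
  by (induction n) (simp_all add: iterate_poly_Suc pcompose_assoc pcompose_pCons)

lemma linear_factors_dvd:
  fixes p :: "'r::idom poly"
  assumes "finite S" "\<And>a. a \<in> S \<Longrightarrow> poly p a = 0"
  shows "(\<Prod>a\<in>S. [:- a, 1:]) dvd p"
  using assms
proof (induction S arbitrary: p rule: finite_induct)
  case (insert b S)
  then obtain q where q: "p = [:- b, 1:] * q"
    by (metis dvdE insertI1 poly_eq_0_iff_dvd)
  have "poly q a = 0" if "a \<in> S" for a
    using insert.prems[of a] insert.hyps that q by auto
  then have "(\<Prod>a\<in>S. [:- a, 1:]) dvd q"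
    by (rule insert.IH)
  then show ?case
    using insert.hyps q by (simp add: mult_dvd_mono del: mult_pCons_left)
qed simp

section \<open>Finite subfields and the Frobenius map\<close>

text \<open>
  Such a \<open>K\<close> is a finite field inside a possibly infinite one. With \<open>Q = card K\<close>, the \<open>Q\<close>-th
  power map plays the role of Frobenius: its fixed points are exactly the elements of \<open>K\<close>, so
  being a polynomial over \<open>K\<close> becomes an equation.
\<close>

locale finite_subring_of_field =
  fixes K :: "'b::field set"
  assumes finite: "finite K"
    and zero: "0 \<in> K" and one: "1 \<in> K"
    and add_closed: "x \<in> K \<Longrightarrow> y \<in> K \<Longrightarrow> x + y \<in> K"
    and mult_closed: "x \<in> K \<Longrightarrow> y \<in> K \<Longrightarrow> x * y \<in> K"
begin

lemma card_ge_2: "card K \<ge> 2"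
proof -
  have "card {0, 1 :: 'b} \<le> card K"
    using finite zero one by (intro card_mono) auto
  then show ?thesis by simp
qed

lemma power_card:
  assumes "x \<in> K"
  shows "x ^ card K = x"
proof (cases "x = 0")
  case False
  have "(*) x ` (K - {0}) = K - {0}"
    using finite False assms mult_closed
    by (intro endo_inj_surj) (auto simp: inj_on_def)
  moreover have inj: "inj_on ((*) x) (K - {0})"
    using False by (auto simp: inj_on_def)
  ultimately have "\<Prod>(K - {0}) = (\<Prod>y\<in>K - {0}. x * y)"
    by (metis (no_types, lifting) prod.reindex_cong)
  also have "\<dots> = x ^ card (K - {0}) * \<Prod>(K - {0})"
    by (simp add: prod.distrib)
  finally have "x ^ card (K - {0}) = 1"
    using finite by simp
  then show ?thesis
    using zero finite card_ge_2 power_eq_if[of x "card K"] by (auto simp: card_Diff_singleton)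
qed (use card_ge_2 in \<open>simp add: power_0_left\<close>)

text \<open>
  Additivity of the \<open>Q\<close>-th power map is obtained without knowing that \<open>Q\<close> is a power of the
  characteristic. The polynomial \<open>(1 + Y)^Q - Y^Q - 1\<close> has degree less than \<open>Q\<close>, because the
  leading terms cancel, and it vanishes on the \<open>Q\<close> elements of \<open>K\<close>, where the \<open>Q\<close>-th power
  map is the identity. Hence it is zero, and scaling gives the general case.
\<close>

lemma power_card_add: "(x + y) ^ card K = x ^ card K + (y :: 'b) ^ card K"
proof -
  define p where "p = [:1 :: 'b, 1:] ^ card K - [:0, 1:] ^ card K - 1"
  have "p = 0"
  proof (rule ccontr)
    assume "p \<noteq> 0"
    have "poly p z = 0" if "z \<in> K" for z
      using power_card[OF that] power_card[OF add_closed[OF one that]] by (simp add: p_def)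
    then have "card K \<le> card {z. poly p z = 0}"
      using poly_roots_finite[OF \<open>p \<noteq> 0\<close>] by (intro card_mono) auto
    also have "\<dots> \<le> degree p"
      by (rule card_poly_roots_bound) fact
    finally have "card K \<le> degree p" .
    moreover have "degree p \<le> card K"
      unfolding p_def by (intro degree_diff_le) (simp_all add: degree_linear_power)
    moreover have "Polynomial.coeff p (card K) = 0"
      using card_ge_2 unfolding p_def by (simp add: coeff_linear_power coeff_eq_0)
    ultimately show False
      using \<open>p \<noteq> 0\<close> leading_coeff_0_iff[of p] by simp
  qed
  then have "poly p z = 0" for z by simp
  then have *: "(1 + z) ^ card K = z ^ card K + 1" for z :: 'b
    by (simp add: p_def diff_diff_eq)
  show ?thesis
  proof (cases "x = 0")
    case True
    then show ?thesis using card_ge_2 by (simp add: power_0_left)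
  next
    case False
    have "x + y = x * (1 + y / x)"
      using False by (simp add: field_simps)
    then have "(x + y) ^ card K = (x * (1 + y / x)) ^ card K"
      by simp
    also have "\<dots> = x ^ card K * ((y / x) ^ card K + 1)"
      by (simp only: power_mult_distrib *)
    also have "\<dots> = x ^ card K + y ^ card K"
      using False by (simp add: field_simps power_divide)
    finally show ?thesis .
  qed
qed

lemma frobenius_hom: "unital_ring_hom (\<lambda>x :: 'b. x ^ card K)"
  by unfold_locales (simp_all add: power_card_add power_mult_distrib)

lemma frobenius_fixed_iff: "x ^ card K = x \<longleftrightarrow> x \<in> K"
proof
  assume x: "x ^ card K = x"
  define p where "p = [:0 :: 'b, 1:] ^ card K - [:0, 1:]"
  have "Polynomial.coeff p (card K) = 1"
    using card_ge_2 unfolding p_def by (simp add: coeff_linear_power coeff_eq_0)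
  then have "p \<noteq> 0" by auto
  have "degree p \<le> card K"
    using card_ge_2 unfolding p_def by (intro degree_diff_le) (simp_all add: degree_linear_power)
  then have "card {z. poly p z = 0} \<le> card K"
    using card_poly_roots_bound[OF \<open>p \<noteq> 0\<close>] by simp
  moreover have "K \<subseteq> {z. poly p z = 0}"
    by (auto simp: p_def power_card)
  ultimately have "{z. poly p z = 0} \<subseteq> K"
    using card_seteq[of "{z. poly p z = 0}" K] poly_roots_finite[OF \<open>p \<noteq> 0\<close>] by blast
  then show "x \<in> K"
    using x by (auto simp: p_def)
qed (rule power_card)

end

section \<open>Even polynomials with square constant term\<close>

text \<open>
  This is the reason for reducibility modulo every prime, with \<open>\<phi>\<close> the Frobenius map of a finite
  field \<open>K\<close> and "fixed by \<open>\<phi>\<close>" meaning "with coefficients in \<open>K\<close>". The linear factors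
  belonging to the \<open>\<phi>\<close>-orbit of one root multiply to a factor fixed by \<open>\<phi>\<close>, which is the
  desired proper factor unless the orbit consists of all \<open>2 * d\<close> roots. In that case negation,
  which permutes the roots because \<open>G\<close> is even, is a power of \<open>\<phi>\<close> of order two on the orbit,
  that is, \<open>\<phi>^d\<close>. The product \<open>\<delta>\<close> over half of the orbit then satisfies \<open>\<phi> \<delta> = - \<delta>\<close> and,
  as \<open>d\<close> is even, \<open>\<delta>\<^sup>2 = c\<^sup>2\<close>, so that \<open>\<delta> = \<plusminus>c\<close> is also fixed by \<open>\<phi>\<close>.
\<close>

lemma even_poly_splits:
  fixes G :: "'b::alg_closed_field poly" and \<phi> :: "'b \<Rightarrow> 'b"
  assumes "unital_ring_hom \<phi>"
    and fixed: "map_poly \<phi> G = G"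
    and monic: "lead_coeff G = 1"
    and deg: "degree G = 2 * d" and "even d" "d > 0"
    and even: "\<And>x. poly G (- x) = poly G x"
    and const: "poly G 0 = c ^ 2" "\<phi> c = c"
    and two: "(2 :: 'b) \<noteq> 0"
  shows "\<exists>A B. G = A * B \<and> map_poly \<phi> A = A \<and> map_poly \<phi> B = B \<and> degree A > 0 \<and> degree B > 0"
proof -
  interpret unital_ring_hom \<phi> by fact
  have "G \<noteq> 0" using monic by auto
  have inj: "inj \<phi>"
  proof (rule injI)
    fix x y assume "\<phi> x = \<phi> y"
    then have "\<phi> (x - y) = 0" by (simp add: diff)
    then show "x = y"
      using mult[of "x - y" "inverse (x - y)"] one by (cases "x - y = 0") auto
  qed
  then have inj_iter: "inj (\<phi> ^^ k)" for k
    by (rule inj_fn)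
  obtain \<alpha> where \<alpha>: "poly G \<alpha> = 0"
    using alg_closed_imp_poly_has_root[of G] deg \<open>d > 0\<close> by auto
  define a where "a i = (\<phi> ^^ i) \<alpha>" for i
  have a_0: "a 0 = \<alpha>" and a_Suc: "\<phi> (a i) = a (Suc i)" for i
    by (simp_all add: a_def)
  have a_add: "a (i + j) = (\<phi> ^^ i) (a j)" for i j
    by (simp add: a_def funpow_add)
  have root: "poly G (a i) = 0" for i
  proof (induction i)
    case (Suc i)
    then show ?case
      using poly_map_poly[of G "a i"] by (simp add: fixed a_Suc)
  qed (simp add: a_0 \<alpha>)
  have periodic: "a k = \<alpha>" if "a (i + k) = a i" for i k
    using that inj_iter[of i] a_add[of i k] a_add[of i 0] by (auto simp: a_0 inj_def)
  have "\<exists>e>0. a e = \<alpha>"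
  proof -
    have "finite (range a)"
      using root poly_roots_finite[OF \<open>G \<noteq> 0\<close>] by (rule_tac finite_subset) auto
    then have "\<not> inj a"
      using finite_imageD by blast
    then obtain i j where "i < j" "a i = a j"
      by (metis linorder_injI)
    then have "a (j - i) = \<alpha>"
      using periodic[of i "j - i"] by simp
    then show ?thesis
      using \<open>i < j\<close> by (intro exI[of _ "j - i"]) simp
  qed
  \<comment> \<open>The length of the orbit of \<open>\<alpha>\<close>.\<close>
  define e where "e = (LEAST e. e > 0 \<and> a e = \<alpha>)"
  have e: "e > 0" "a e = \<alpha>"
    using LeastI_ex[OF \<open>\<exists>e>0. a e = \<alpha>\<close>] by (simp_all add: e_def)
  have e_least: "e \<le> k" if "k > 0" "a k = \<alpha>" for k
    unfolding e_def using that by (intro Least_le) simp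
  have a_inj: "inj_on a {..<e}"
  proof (rule linorder_inj_onI)
    fix i j assume "i < j" "i \<in> {..<e}" "j \<in> {..<e}"
    then show "a i \<noteq> a j"
      using periodic[of i "j - i"] e_least[of "j - i"] by auto
  qed auto
  define M where "M = (\<Prod>i<e. [:- a i, 1:])"
  have "M = (\<Prod>x\<in>a ` {..<e}. [:- x, 1:])"
    by (simp add: M_def prod.reindex[OF a_inj])
  then have "M dvd G"
    using linear_factors_dvd[of "a ` {..<e}" G] root by auto
  then obtain B where B: "G = M * B" by (rule dvdE)
  have shift: "(\<Prod>i<e. f (a (Suc i))) = (\<Prod>i<e. f (a i))" for f :: "'b \<Rightarrow> 'b poly"
  proof -
    obtain e' where e': "e = Suc e'" using e(1) gr0_implies_Suc by blast
    have "(\<Prod>i<e. f (a (Suc i))) = (\<Prod>i<e'. f (a (Suc i))) * f (a 0)"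
      using e(2) by (simp add: e' a_0)
    also have "\<dots> = (\<Prod>i<e. f (a i))"
      unfolding e' prod.lessThan_Suc_shift by (simp add: mult.commute)
    finally show ?thesis .
  qed
  interpret P: unital_ring_hom "map_poly \<phi>" by (rule map_poly_hom)
  have M_fixed: "map_poly \<phi> M = M"
    using shift[of "\<lambda>x. [:- x, 1:]"] by (simp add: M_def P.prod map_poly_pCons' uminus one a_Suc)
  have "M \<noteq> 0" "B \<noteq> 0" using \<open>G \<noteq> 0\<close> B by auto
  have "M * map_poly \<phi> B = M * B"
    using fixed by (simp add: B P.mult M_fixed)
  then have B_fixed: "map_poly \<phi> B = B"
    using \<open>M \<noteq> 0\<close> by simp
  have deg_M: "degree M = e"
    unfolding M_def by (subst degree_prod_eq_sum_degree) auto
  have deg_sum: "e + degree B = 2 * d"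
    using degree_mult_eq[OF \<open>M \<noteq> 0\<close> \<open>B \<noteq> 0\<close>] deg_M deg B by simp
  have "e \<noteq> 2 * d"
  proof
    assume full: "e = 2 * d"
    have "\<exists>b. B = [:b:]"
      using deg_sum full degree_eq_zeroE[of B] by auto
    moreover have "lead_coeff M = 1"
      by (simp add: M_def lead_coeff_prod)
    ultimately have "B = 1"
      using monic B by (auto simp: lead_coeff_mult one_pCons)
    then have G: "G = M" using B by simp
    have roots: "x \<in> a ` {..<e}" if "poly G x = 0" for x
      using that by (auto simp: G M_def poly_prod)
    have "\<alpha> \<noteq> 0"
    proof
      assume "\<alpha> = 0"
      then have "e \<le> 1" using e_least[of 1] by (simp add: a_def)
      then show False using full \<open>d > 0\<close> by simp
    qed
    have "poly G (- \<alpha>) = 0" using even \<alpha> by simp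
    then obtain k where k: "k < e" "a k = - \<alpha>"
      using roots by fastforce
    \<comment> \<open>\<open>- \<alpha>\<close> lies \<open>k\<close> steps along the orbit; applying \<open>\<phi>\<close> spreads this to all roots.\<close>
    have neg: "a (i + k) = - a i" for i
    proof (induction i)
      case (Suc i)
      then show ?case
        by (metis a_Suc add_Suc uminus)
    qed (simp add: k a_0)
    have "k > 0"
    proof (rule ccontr)
      assume "\<not> k > 0"
      then have "2 * \<alpha> = 0" using k a_0 by simp
      then show False using two \<open>\<alpha> \<noteq> 0\<close> by simp
    qed
    have per: "a (i + e) = a i" for i
      using a_add[of i e] a_add[of i 0] e(2) a_0 by simp
    have "a (k + k) = \<alpha>" using neg[of k] k(2) by simp
    have "k = d"
    proof (rule ccontr)
      assume "k \<noteq> d"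
      show False
      proof (cases "k < d")
        case True
        then show False
          using e_least[of "k + k"] \<open>a (k + k) = \<alpha>\<close> full \<open>k > 0\<close> by simp
      next
        case False
        then have "a (k + k - e) = \<alpha>"
          using \<open>a (k + k) = \<alpha>\<close> per[of "k + k - e"] full by (simp add: mult_2)
        then show False
          using e_least[of "k + k - e"] False full \<open>k \<noteq> d\<close> k(1) by simp
      qed
    qed
    \<comment> \<open>Applying \<open>\<phi>\<close> replaces the factor \<open>\<alpha>\<close> of \<open>\<delta>\<close> by \<open>\<phi>^d \<alpha> = - \<alpha>\<close>.\<close>
    define \<delta> where "\<delta> = (\<Prod>i<d. a i)"
    have "\<alpha> * \<phi> \<delta> = (\<Prod>i<Suc d. a i)"
      by (simp only: \<delta>_def prod a_Suc a_0[symmetric] prod.lessThan_Suc_shift comp_def)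
    also have "\<dots> = \<alpha> * (- \<delta>)"
      using k(2) \<open>k = d\<close> by (simp add: \<delta>_def)
    finally have flip: "\<phi> \<delta> = - \<delta>"
      using \<open>\<alpha> \<noteq> 0\<close> by (metis mult_left_cancel)
    have "c ^ 2 = (\<Prod>i<2 * d. - a i)"
      using const(1) by (simp add: G M_def full poly_prod)
    also have "\<dots> = (\<Prod>i<2 * d. a i)"
      by (simp add: prod_uminus)
    also have "\<dots> = (\<Prod>i<d. a i) * (\<Prod>i=d..<d + d. a i)"
      by (simp add: lessThan_atLeast0 prod.atLeastLessThan_concat mult_2)
    also have "(\<Prod>i=d..<d + d. a i) = (\<Prod>i<d. a (i + d))"
      using prod.shift_bounds_nat_ivl[of a 0 d d] by (simp add: lessThan_atLeast0)
    also have "(\<Prod>i<d. a (i + d)) = \<delta>"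
      using \<open>even d\<close> neg \<open>k = d\<close> by (simp add: \<delta>_def prod_uminus)
    finally have "c ^ 2 = \<delta> ^ 2" by (simp add: \<delta>_def power2_eq_square)
    then have "\<phi> \<delta> = \<delta>"
      using const(2) uminus by (auto simp: power2_eq_iff)
    then have "2 * \<delta> = 0" using flip by (simp add: eq_neg_iff_add_eq_0)
    then have "\<delta> = 0" using two by simp
    then have "c = 0" using \<open>c ^ 2 = \<delta> ^ 2\<close> by simp
    then have "poly G 0 = 0" using const by simp
    \<comment> \<open>A vanishing constant term makes \<open>0\<close> a root, and \<open>- 0 = 0\<close> shortens the orbit to \<open>k < e\<close>.\<close>
    then obtain i where i: "i < e" "a i = 0"
      using roots by fastforce
    then have "a i = a (i + k)" using neg by simp
    then have "a k = \<alpha>" using periodic by metis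
    then show False using k e_least[of k] \<open>k > 0\<close> by simp
  qed
  then have "degree B > 0" using deg_sum by simp
  then show ?thesis
    using B M_fixed B_fixed deg_M e(1) by auto
qed

section \<open>Irreducibility of compositions with a quadratic polynomial\<close>

lemma even_odd_decomposition:
  fixes p :: "'r::comm_ring_1 poly"
  obtains a b where "p = pcompose a [:0, 0, 1:] + [:0, 1:] * pcompose b [:0, 0, 1:]"
proof -
  have "\<exists>a b. p = pcompose a [:0, 0, 1:] + [:0, 1:] * pcompose b [:0, 0, 1:]"
  proof (induction p)
    case (pCons c p)
    then obtain a b where ab: "p = pcompose a [:0, 0, 1:] + [:0, 1:] * pcompose b [:0, 0, 1:]"
      by blast
    have "pCons c p = pcompose (pCons c b) [:0, 0, 1:] + [:0, 1:] * pcompose a [:0, 0, 1:]"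
      by (subst ab) (simp add: pcompose_pCons)
    then show ?case by blast
  qed (auto intro!: exI[of _ 0])
  then show thesis using that by blast
qed

text \<open>
  Writing \<open>h = a(y\<^sup>2) + y * b(y\<^sup>2)\<close> gives \<open>h(y) h(-y) = a(y\<^sup>2)\<^sup>2 - y\<^sup>2 * b(y\<^sup>2)\<^sup>2\<close>, a polynomial in \<open>y\<^sup>2\<close>,
  hence also in \<open>y\<^sup>2 + c\<close>. The polynomial \<open>N\<close> is the norm of \<open>h\<close> for the extension generated by
  \<open>y\<close> over the polynomials in \<open>y\<^sup>2 + c\<close>.
\<close>

lemma twisted_square_is_even:
  fixes h :: "'r::comm_ring_1 poly"
  obtains N where "pcompose N [:c, 0, 1:] = h * pcompose h [:0, -1:]"
proof -
  obtain a b where h: "h = pcompose a [:0, 0, 1:] + [:0, 1:] * pcompose b [:0, 0, 1:]"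
    by (rule even_odd_decomposition)
  have sq: "pcompose [:0, 0, 1:] [:0, -1:] = ([:0, 0, 1:] :: 'r poly)"
    by (simp add: pcompose_pCons)
  have neg: "pcompose h [:0, -1:] = pcompose a [:0, 0, 1:] - [:0, 1:] * pcompose b [:0, 0, 1:]"
    by (subst h) (simp add: pcompose_add pcompose_mult pcompose_assoc[symmetric] sq pcompose_pCons)
  have shift: "pcompose [:- c, 1:] [:c, 0, 1:] = [:0, 0, 1:]"
    by (simp add: pcompose_pCons)
  have "pcompose (pcompose (a * a - [:0, 1:] * (b * b)) [:- c, 1:]) [:c, 0, 1:] =
      pcompose (a * a - [:0, 1:] * (b * b)) [:0, 0, 1:]"
    by (simp only: pcompose_assoc[symmetric] shift)
  also have "\<dots> = h * pcompose h [:0, -1:]"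
    unfolding neg
    by (subst h) (simp add: pcompose_diff pcompose_mult pcompose_pCons algebra_simps)
  finally show thesis by (rule that)
qed

text \<open>
  For a factorization \<open>P(y\<^sup>2 + c) = h * k\<close> into nonunits, the norms of \<open>h\<close> and \<open>k\<close> multiply to
  \<open>P\<^sup>2\<close>, and neither norm is a unit. As \<open>P\<close> is prime, both norms are associated to \<open>P\<close>.
  Normalizing \<open>h\<close> to be monic fixes the unit.
\<close>

lemma reducible_pcompose_quadratic:
  fixes P :: "'b::field poly"
  assumes irr: "irreducible P" and monic: "lead_coeff P = 1"
    and red: "\<not> irreducible (pcompose P [:c, 0, 1:])"
  obtains h where "degree h = degree P" "lead_coeff h = 1"
    "h * pcompose h [:0, -1:] = smult ((-1) ^ degree P) (pcompose P [:c, 0, 1:])"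
proof -
  define s where "s = [:c, 0, 1:]"
  have deg_s: "degree s = 2" and lc_s: "lead_coeff s = 1"
    by (simp_all add: s_def)
  define q where "q = pcompose P s"
  have "P \<noteq> 0" and "\<not> is_unit P" using irr by (auto simp: irreducible_def)
  then have "degree P > 0"
    using is_unit_iff_degree by blast
  have deg_q: "degree q = 2 * degree P"
    by (simp add: q_def degree_pcompose deg_s)
  have lc_q: "lead_coeff q = 1"
    using deg_s lc_s monic by (simp add: q_def lead_coeff_comp)
  have "q \<noteq> 0" using lc_q by auto
  have "\<not> is_unit q"
    using deg_q \<open>degree P > 0\<close> \<open>q \<noteq> 0\<close> by (simp add: is_unit_iff_degree)
  then obtain h k where hk: "q = h * k" "\<not> is_unit h" "\<not> is_unit k"
    using red \<open>q \<noteq> 0\<close> unfolding q_def s_def irreducible_def by blast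
  then have "h \<noteq> 0" "k \<noteq> 0" using \<open>q \<noteq> 0\<close> by auto
  obtain Nh where Nh: "pcompose Nh s = h * pcompose h [:0, -1:]"
    unfolding s_def by (rule twisted_square_is_even)
  obtain Nk where Nk: "pcompose Nk s = k * pcompose k [:0, -1:]"
    unfolding s_def by (rule twisted_square_is_even)
  have degN: "degree Nh = degree h" "degree Nk = degree k"
    using arg_cong[OF Nh, of degree] arg_cong[OF Nk, of degree] \<open>h \<noteq> 0\<close> \<open>k \<noteq> 0\<close>
    by (auto simp: degree_pcompose deg_s degree_mult_eq pcompose_eq_0_iff)
  have deg_hk: "degree h > 0" "degree k > 0"
    using hk \<open>h \<noteq> 0\<close> \<open>k \<noteq> 0\<close> by (auto simp: is_unit_iff_degree)
  have "pcompose q [:0, -1:] = q"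
    by (simp add: q_def pcompose_assoc[symmetric] s_def pcompose_pCons)
  then have "pcompose (Nh * Nk) s = pcompose (P * P) s"
    using hk(1) by (simp add: pcompose_mult Nh Nk q_def[symmetric] algebra_simps)
  then have "pcompose (Nh * Nk - P * P) s = 0"
    by (simp add: pcompose_diff)
  then have NN: "Nh * Nk = P * P"
    using pcompose_eq_0[of "Nh * Nk - P * P" s] deg_s by simp
  have nonunit: "\<not> is_unit Nh" "\<not> is_unit Nk"
    using degN deg_hk by (auto elim!: is_unit_polyE)
  have "\<exists>u. Nh = smult u P"
  proof -
    have "P dvd Nh * Nk" using NN by simp
    then consider "P dvd Nh" | "P dvd Nk"
      using field_poly_irreducible_imp_prime[OF irr] prime_elem_dvd_multD by blast
    then show ?thesis
    proof cases
      case 1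
      then obtain t where t: "Nh = P * t" by (rule dvdE)
      then have "P = t * Nk" using NN \<open>P \<noteq> 0\<close> by simp
      then have "is_unit t" using irr nonunit irreducibleD by blast
      then obtain u where "t = [:u:]" by (rule is_unit_polyE)
      then show ?thesis using t by auto
    next
      case 2
      then obtain t where t: "Nk = P * t" by (rule dvdE)
      then have P: "P = t * Nh" using NN \<open>P \<noteq> 0\<close> by (simp add: algebra_simps)
      then have "is_unit t" using irr nonunit irreducibleD by blast
      then obtain u where u: "t = [:u:]" "u dvd 1" by (rule is_unit_polyE)
      then have "u \<noteq> 0" by auto
      then have "Nh = smult (inverse u) P"
        by (subst P) (simp add: u(1))
      then show ?thesis by blast
    qed
  qed
  then obtain u where u: "Nh = smult u P" by blast
  have hh: "h * pcompose h [:0, -1:] = smult u q"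
    using Nh u by (simp add: q_def pcompose_smult)
  have "u \<noteq> 0" using u nonunit(1) degN deg_hk by auto
  have deg_h: "degree h = degree P"
    using degN u \<open>u \<noteq> 0\<close> by simp
  define l where "l = lead_coeff h"
  have "l \<noteq> 0" using \<open>h \<noteq> 0\<close> by (simp add: l_def)
  have "lead_coeff (pcompose h [:0, -1:]) = l * (-1) ^ degree P"
    by (simp add: lead_coeff_comp l_def deg_h)
  then have "l * (l * (-1) ^ degree P) = u"
    using arg_cong[OF hh, of lead_coeff] lc_q by (simp add: lead_coeff_mult l_def)
  then have u_eq: "inverse l * inverse l * u = (-1) ^ degree P"
    using \<open>l \<noteq> 0\<close> by (auto simp: field_simps)
  show thesis
  proof (rule that)
    show "degree (smult (inverse l) h) = degree P"
      using \<open>l \<noteq> 0\<close> deg_h by simp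
    show "lead_coeff (smult (inverse l) h) = 1"
      using \<open>l \<noteq> 0\<close> by (simp add: l_def)
    show "smult (inverse l) h * pcompose (smult (inverse l) h) [:0, -1:] =
        smult ((-1) ^ degree P) (pcompose P [:c, 0, 1:])"
      using hh by (simp add: pcompose_smult u_eq[symmetric] q_def s_def mult.assoc)
  qed
qed

lemma degree_iterate_quadratic:
  fixes c :: "'r::idom"
  shows "degree (iterate_poly [:c, 0, 1:] n) = 2 ^ n"
  by (induction n) (simp_all add: iterate_poly_Suc degree_pcompose)

lemma lead_coeff_iterate_quadratic:
  fixes c :: "'r::idom"
  shows "lead_coeff (iterate_poly [:c, 0, 1:] n) = 1"
  by (induction n)
    (simp_all add: iterate_poly_Suc lead_coeff_comp degree_iterate_quadratic)

lemma degree_iterate_quadratic_plus: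
  fixes c g :: "'r::idom"
  shows "degree (iterate_poly [:c, 0, 1:] n + [:g:]) = 2 ^ n"
  using degree_iterate_quadratic[of c n] by (subst degree_add_eq_left) auto

lemma lead_coeff_iterate_quadratic_plus:
  fixes c g :: "'r::idom"
  shows "lead_coeff (iterate_poly [:c, 0, 1:] n + [:g:]) = 1"
  using lead_coeff_iterate_quadratic[of c n]
  by (simp add: degree_iterate_quadratic_plus degree_iterate_quadratic coeff_eq_0)

lemma iterate_quadratic_plus_Suc:
  fixes c g :: "'r::comm_ring_1"
  shows "iterate_poly [:c, 0, 1:] (Suc n) + [:g:] = pcompose (iterate_poly [:c, 0, 1:] n + [:g:]) [:c, 0, 1:]"
  by (simp only: iterate_poly_Suc2 pcompose_add pcompose_const)

text \<open>
  At \<open>y = 0\<close> the relation \<open>h(y) h(-y) = \<plusminus>Q\<^sub>i\<^sub>+\<^sub>1(y)\<close> exhibits \<open>\<plusminus>Q\<^sub>i\<^sub>+\<^sub>1(0)\<close> as a square, so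
  irreducibility climbs from the linear polynomial \<open>Q\<^sub>0\<close> as long as no such value is a square up
  to sign.
\<close>

lemma iterate_quadratic_irreducible:
  fixes c g :: "'b::field"
  assumes "\<And>i z. i < n \<Longrightarrow> z ^ 2 \<noteq> poly (iterate_poly [:c, 0, 1:] (Suc i) + [:g:]) 0"
    and "\<And>i z. i < n \<Longrightarrow> z ^ 2 \<noteq> - poly (iterate_poly [:c, 0, 1:] (Suc i) + [:g:]) 0"
  shows "irreducible (iterate_poly [:c, 0, 1:] n + [:g:])"
  using assms
proof (induction n)
  case 0
  then show ?case by (simp add: irreducible_linear_field_poly)
next
  case (Suc n)
  define P where "P = iterate_poly [:c, 0, 1:] n + [:g:]"
  have P: "irreducible P"
    unfolding P_def using Suc by simp
  have "irreducible (pcompose P [:c, 0, 1:])"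
  proof (rule ccontr)
    assume "\<not> irreducible (pcompose P [:c, 0, 1:])"
    then obtain h where h: "h * pcompose h [:0, -1:] = smult ((-1) ^ degree P) (pcompose P [:c, 0, 1:])"
      using reducible_pcompose_quadratic[OF P] lead_coeff_iterate_quadratic_plus[of c n g]
      unfolding P_def by metis
    have "poly h 0 ^ 2 = (-1) ^ degree P * poly (iterate_poly [:c, 0, 1:] (Suc n) + [:g:]) 0"
      using arg_cong[OF h, of "\<lambda>p. poly p 0"]
      by (simp add: iterate_quadratic_plus_Suc P_def[symmetric] poly_pcompose power2_eq_square)
    then show False
      using Suc.prems[of n "poly h 0"] by (cases "even (degree P)") auto
  qed
  then show ?case
    by (simp add: iterate_quadratic_plus_Suc P_def)
qed

lemma irreducible_pcompose_shift:
  fixes p :: "'b::field poly"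
  assumes "irreducible p"
  shows "irreducible (pcompose p [:c, 1:])"
proof (rule irreducibleI)
  have deg: "degree (pcompose q [:a, 1:]) = degree q" for q :: "'b poly" and a
    by (simp add: degree_pcompose)
  have unit_iff: "is_unit (pcompose q [:a, 1:]) \<longleftrightarrow> is_unit q" for q :: "'b poly" and a
    by (cases "q = 0") (auto simp: is_unit_iff_degree deg pcompose_eq_0_iff)
  show "pcompose p [:c, 1:] \<noteq> 0" "\<not> is_unit (pcompose p [:c, 1:])"
    using assms by (auto simp: pcompose_eq_0_iff unit_iff irreducible_def)
  fix a b assume "pcompose p [:c, 1:] = a * b"
  then have "pcompose (pcompose p [:c, 1:]) [:- c, 1:] = pcompose a [:- c, 1:] * pcompose b [:- c, 1:]"
    by (simp add: pcompose_mult)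
  then have "p = pcompose a [:- c, 1:] * pcompose b [:- c, 1:]"
    by (simp add: pcompose_assoc[symmetric] pcompose_pCons)
  then show "is_unit a \<or> is_unit b"
    using assms irreducibleD unit_iff by blast
qed

lemma odd_degree_not_square_fract:
  fixes x :: "'a::field poly"
  assumes "odd (degree x)"
  shows "z ^ 2 \<noteq> to_fract x"
proof
  assume z: "z ^ 2 = to_fract x"
  obtain a b where ab: "z = Fract a b" "b \<noteq> 0" by (cases z) auto
  then have "to_fract (a ^ 2) = to_fract (x * b ^ 2)"
    using z[symmetric] by (simp add: Fract_conv_to_fract field_simps power2_eq_square)
  then have eq: "a ^ 2 = x * b ^ 2" by (simp only: to_fract_eq_iff)
  have "x \<noteq> 0" using assms by auto
  then have "degree (a ^ 2) = degree x + 2 * degree b"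
    using ab eq by (simp add: degree_mult_eq degree_power_eq)
  moreover have "even (degree (a ^ 2))"
    by (cases "a = 0") (simp_all add: degree_power_eq)
  ultimately show False using assms by simp
qed

text \<open>
  Gauss's lemma is avoided: a factor over the fraction field is only rescaled to have coefficients
  in the ring, and the square of the scaling factor is carried along.
\<close>

lemma clear_denominators:
  fixes p :: "'r::idom fract poly"
  obtains s H where "s \<noteq> 0" "smult (to_fract s) p = fract_poly H"
proof -
  have "\<exists>s H. s \<noteq> 0 \<and> smult (to_fract s) p = fract_poly H"
  proof (induction p)
    case (pCons x p)
    then obtain s H where sH: "s \<noteq> 0" "smult (to_fract s) p = fract_poly H" by blast
    obtain a b where ab: "x = Fract a b" "b \<noteq> 0" by (cases x) auto
    have "smult (to_fract (s * b)) (pCons x p) =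
        pCons (to_fract (s * a)) (smult (to_fract b) (smult (to_fract s) p))"
      using ab by (simp add: Fract_conv_to_fract mult_ac)
    also have "\<dots> = fract_poly (pCons (s * a) (smult b H))"
      by (simp only: sH(2) fract_poly_smult[symmetric]) (simp add: map_poly_pCons)
    finally show ?case
      using sH(1) ab(2) by (intro exI[of _ "s * b"] exI[of _ "pCons (s * a) (smult b H)"]) simp
  next
    case 0
    show ?case by (intro exI[of _ 1] exI[of _ 0]) simp
  qed
  then show thesis using that by blast
qed

section \<open>Newton polygons and products \<open>h(y) h(-y)\<close>\<close>

text \<open>
  A discrete valuation, nonnegative on the ring. The value at \<open>0\<close>, which would be infinite, is left
  unspecified, so all laws are restricted to nonzero arguments.
\<close>

locale nat_valuation =
  fixes v :: "'r::idom \<Rightarrow> nat"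
  assumes v_mult: "a \<noteq> 0 \<Longrightarrow> b \<noteq> 0 \<Longrightarrow> v (a * b) = v a + v b"
    and v_add: "a \<noteq> 0 \<Longrightarrow> b \<noteq> 0 \<Longrightarrow> a + b \<noteq> 0 \<Longrightarrow> min (v a) (v b) \<le> v (a + b)"
begin

lemma v_one [simp]: "v 1 = 0"
  using v_mult[of 1 1] by simp

lemma v_uminus [simp]: "v (- a) = v a"
proof (cases "a = 0")
  case False
  have "v (- 1) = 0"
    using v_mult[of "- 1" "- 1"] by simp
  then show ?thesis
    using v_mult[of "- 1" a] False by simp
qed simp

lemma v_power: "a \<noteq> 0 \<Longrightarrow> v (a ^ n) = n * v a"
  by (induction n) (simp_all add: v_mult)

lemma v_unit: "a dvd 1 \<Longrightarrow> v a = 0"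
  using v_mult by (metis add_is_0 dvdE mult_not_zero one_neq_zero v_one)

lemma v_dvd: "a dvd b \<Longrightarrow> b \<noteq> 0 \<Longrightarrow> v a \<le> v b"
  by (auto elim!: dvdE simp: v_mult)

lemma v_add_dominated:
  assumes "a \<noteq> 0" "b = 0 \<or> v a < v b"
  shows "a + b \<noteq> 0" "v (a + b) = v a"
proof -
  show nz: "a + b \<noteq> 0"
    using assms by (auto simp: add_eq_0_iff2)
  show "v (a + b) = v a"
  proof (cases "b = 0")
    case False
    have "min (v a) (v b) \<le> v (a + b)"
      using v_add[of a b] nz assms False by auto
    moreover have "min (v (a + b)) (v b) \<le> v a"
      using v_add[of "a + b" "- b"] nz assms False by auto
    ultimately show ?thesis using assms False by auto
  qed simp
qed

text \<open>
  The factor \<open>c\<close> is there because Newton polygons with a slope of denominator \<open>c\<close> lead to bounds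
  on \<open>c * v\<close>.
\<close>

lemma v_sum_gt:
  assumes "\<And>i. i \<in> S \<Longrightarrow> f i = 0 \<or> k < c * v (f i)" and "sum f S \<noteq> 0"
  shows "k < c * v (sum f S)"
  using assms
proof (induction S rule: infinite_finite_induct)
  case (insert x S)
  show ?case
  proof (cases "f x = 0 \<or> sum f S = 0")
    case True
    then show ?thesis
      using insert.IH insert.prems insert.hyps
      by (metis add.left_neutral add.right_neutral insertCI sum.insert)
  next
    case False
    then have "k < c * v (f x)" "k < c * v (sum f S)"
      using insert by auto
    moreover have "min (v (f x)) (v (sum f S)) \<le> v (f x + sum f S)"
      using False insert by (intro v_add) auto
    ultimately show ?thesis
      using insert.hyps
      by (simp add: min_def split: if_splits)
       (meson le_trans less_le_trans mult_le_mono2)+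
  qed
qed auto

text \<open>
  Give the term of degree \<open>i\<close> with coefficient \<open>c\<close> the weight \<open>N * v c + e * i\<close>. The hypotheses
  say that the terms of minimal weight in \<open>g\<close> are exactly those of degree \<open>N\<close> and \<open>2 * N\<close>: its
  Newton polygon has an edge of length \<open>N\<close> and height \<open>e\<close> there. Let \<open>i0\<close> be the least degree
  of a term of minimal weight in \<open>H(y)\<close>; it is the same for \<open>H(-y)\<close>. In the product the term of
  degree \<open>2 * i0\<close> then has minimal weight, since all other contributions to it have larger weight.
  Hence \<open>2 * i0\<close> is \<open>N\<close> or \<open>2 * N\<close>. In the first case twice the
  valuation of a coefficient of \<open>H\<close> equals \<open>e + 2 * v s\<close>, but \<open>e\<close> is odd. In the second case all terms of \<open>H\<close> below degree \<open>N\<close> are too heavy to produce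
  the coefficient of degree \<open>N\<close>. The scalar \<open>s\<close> shifts all weights by the same amount.
\<close>

lemma twisted_square_newton_polygon:
  fixes g H :: "'r poly" and s :: 'r
  assumes N: "N > 0" and e: "odd e" and "s \<noteq> 0"
    and deg: "degree g = 2 * N" and monic: "lead_coeff g = 1"
    and middle: "Polynomial.coeff g N \<noteq> 0" "v (Polynomial.coeff g N) = e"
    and above: "\<And>i. i \<noteq> N \<Longrightarrow> i \<noteq> 2 * N \<Longrightarrow> Polynomial.coeff g i \<noteq> 0 \<Longrightarrow>
      2 * e * N < N * v (Polynomial.coeff g i) + e * i"
  shows "H * pcompose H [:0, -1:] \<noteq> smult (s ^ 2) g"
proof
  assume H: "H * pcompose H [:0, -1:] = smult (s ^ 2) g"
  define c where "c = Polynomial.coeff H"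
  define w where "w i = N * v (c i) + e * i" for i
  have "smult (s ^ 2) g \<noteq> 0"
    using \<open>s \<noteq> 0\<close> monic by auto
  then have "H \<noteq> 0" using H by auto
  have "degree H + degree H = 2 * N"
    using arg_cong[OF H, of degree] deg \<open>s \<noteq> 0\<close> \<open>H \<noteq> 0\<close>
    by (simp add: degree_mult_eq degree_pcompose pcompose_eq_0_iff)
  then have deg_H: "degree H = N" by simp
  have coeff: "s ^ 2 * Polynomial.coeff g n = (\<Sum>i\<le>n. c i * ((-1) ^ (n - i) * c (n - i)))" for n
    using arg_cong[OF H, of "\<lambda>p. Polynomial.coeff p n"]
    by (simp add: coeff_mult coeff_pcompose_linear c_def)
  have "c N \<noteq> 0"
    using \<open>H \<noteq> 0\<close> deg_H by (auto simp: c_def)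
  obtain i1 where i1: "c i1 \<noteq> 0" "\<And>i. c i \<noteq> 0 \<Longrightarrow> w i1 \<le> w i"
    using ex_has_least_nat[of "\<lambda>i. c i \<noteq> 0" N w] \<open>c N \<noteq> 0\<close> by blast
  define i0 where "i0 = (LEAST i. c i \<noteq> 0 \<and> w i = w i1)"
  have i0: "c i0 \<noteq> 0" "w i0 = w i1"
    using LeastI[of "\<lambda>i. c i \<noteq> 0 \<and> w i = w i1" i1] i1(1) by (simp_all add: i0_def)
  have min: "w i0 \<le> w i" if "c i \<noteq> 0" for i
    using i0 i1 that by simp
  have first: "w i0 < w i" if "c i \<noteq> 0" "i < i0" for i
    using min[OF that(1)] not_less_Least[of i "\<lambda>i. c i \<noteq> 0 \<and> w i = w i1"] that i0
    by (auto simp: i0_def le_less)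
  have v_term: "v (c i * ((-1) ^ k * c j)) = v (c i) + v (c j)" if "c i \<noteq> 0" "c j \<noteq> 0" for i j k
    using that by (cases "even k") (auto simp: v_mult)
  \<comment> \<open>A product of two terms outweighs \<open>2 * w i0\<close> as soon as one of them lies below degree \<open>i0\<close>.\<close>
  have small: "c i * ((-1) ^ k * c j) = 0 \<or>
      2 * w i0 < N * v (c i * ((-1) ^ k * c j)) + e * (i + j)"
    if "i < i0 \<or> j < i0" for i j k
  proof (cases "c i = 0 \<or> c j = 0")
    case False
    then have "2 * w i0 < w i + w j"
      using that min[of i] min[of j] first[of i] first[of j] by auto
    then show ?thesis
      using False v_term[of i j k] by (simp add: w_def algebra_simps)
  qed auto
  have w_ge: "e * i0 \<le> w i0" by (simp add: w_def)
  have i0_N: "i0 \<le> N"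
    using i0(1) deg_H le_degree[of H i0] by (simp add: c_def)
  define T where "T = (\<Sum>i\<in>{..2 * i0} - {i0}. c i * ((-1) ^ (2 * i0 - i) * c (2 * i0 - i)))"
  have "s ^ 2 * Polynomial.coeff g (2 * i0) = c i0 * ((-1) ^ i0 * c i0) + T"
    unfolding coeff T_def by (subst sum.remove[of _ i0]) (auto simp: mult_2)
  moreover have "T = 0 \<or> v (c i0 * ((-1) ^ i0 * c i0)) < v T"
  proof (rule disjCI)
    assume "\<not> v (c i0 * ((-1) ^ i0 * c i0)) < v T"
    show "T = 0"
    proof (rule ccontr)
      assume "T \<noteq> 0"
      have "2 * w i0 - e * (2 * i0) < N * v T"
        unfolding T_def
      proof (rule v_sum_gt)
        fix i assume i: "i \<in> {..2 * i0} - {i0}"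
        then have "i < i0 \<or> 2 * i0 - i < i0" by auto
        then show "c i * ((-1) ^ (2 * i0 - i) * c (2 * i0 - i)) = 0 \<or>
            2 * w i0 - e * (2 * i0) < N * v (c i * ((-1) ^ (2 * i0 - i) * c (2 * i0 - i)))"
          using small[of i "2 * i0 - i" "2 * i0 - i"] w_ge i by (auto simp: less_diff_conv2)
      qed (use \<open>T \<noteq> 0\<close> in \<open>simp add: T_def\<close>)
      moreover have "2 * w i0 - e * (2 * i0) = N * v (c i0 * ((-1) ^ i0 * c i0))"
        using i0(1) v_term[of i0 i0 i0] by (simp add: w_def algebra_simps)
      ultimately show False
        using \<open>\<not> v (c i0 * ((-1) ^ i0 * c i0)) < v T\<close> by simp
    qed
  qed
  ultimately have sg: "s ^ 2 * Polynomial.coeff g (2 * i0) \<noteq> 0"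
    "v (s ^ 2 * Polynomial.coeff g (2 * i0)) = 2 * v (c i0)"
    using v_add_dominated[of "c i0 * ((-1) ^ i0 * c i0)" T] i0(1) by (simp_all add: v_term)
  then have g_nz: "Polynomial.coeff g (2 * i0) \<noteq> 0"
    and g_v: "2 * v s + v (Polynomial.coeff g (2 * i0)) = 2 * v (c i0)"
    using \<open>s \<noteq> 0\<close> by (simp_all add: v_mult v_power)
  have lead: "s ^ 2 = c N * ((-1) ^ N * c N)"
    using arg_cong[OF H, of lead_coeff] monic \<open>s \<noteq> 0\<close> deg_H
    by (simp add: lead_coeff_mult lead_coeff_comp c_def mult_ac)
  have "v (s ^ 2) = v (c N * ((-1) ^ N * c N))"
    by (simp only: lead)
  then have "v s = v (c N)"
    using \<open>s \<noteq> 0\<close> \<open>c N \<noteq> 0\<close> v_term[of N N N] v_power[of s 2] by linarith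
  then have wN: "w N = N * v s + e * N" by (simp add: w_def)
  have "N * (2 * v s + v (Polynomial.coeff g (2 * i0))) + 2 * e * i0 = 2 * w i0"
    unfolding g_v w_def by (simp add: algebra_simps)
  also have "\<dots> \<le> 2 * w N" using min[OF \<open>c N \<noteq> 0\<close>] by simp
  finally have "N * v (Polynomial.coeff g (2 * i0)) + e * (2 * i0) \<le> 2 * e * N"
    by (simp add: wN algebra_simps)
  then have "2 * i0 = N \<or> 2 * i0 = 2 * N"
    using above[of "2 * i0"] g_nz by force
  then show False
  proof
    assume "2 * i0 = N"
    then have "2 * v s + e = 2 * v (c i0)" using g_v middle by simp
    then show False using e by presburger
  next
    assume "2 * i0 = 2 * N"
    then have "i0 = N" by simp
    have "2 * w i0 - e * N < N * v (\<Sum>i\<le>N. c i * ((-1) ^ (N - i) * c (N - i)))"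
    proof (rule v_sum_gt)
      fix i assume i: "i \<in> {..N}"
      then show "c i * ((-1) ^ (N - i) * c (N - i)) = 0 \<or>
          2 * w i0 - e * N < N * v (c i * ((-1) ^ (N - i) * c (N - i)))"
        using small[of i "N - i" "N - i"] N \<open>i0 = N\<close> w_ge by (auto simp: less_diff_conv2)
    next
      show "(\<Sum>i\<le>N. c i * ((-1) ^ (N - i) * c (N - i))) \<noteq> 0"
        using middle \<open>s \<noteq> 0\<close> by (simp add: coeff[symmetric])
    qed
    then have "2 * w N - e * N < N * (2 * v s + e)"
      using middle \<open>s \<noteq> 0\<close> \<open>i0 = N\<close> by (simp add: coeff[symmetric] v_mult v_power)
    then show False by (simp add: wN algebra_simps)
  qed
qed

end

lemma even_orders_imp_even_degree:
  fixes p :: "'b::alg_closed_field poly"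
  assumes "p \<noteq> 0" "\<And>x. even (Polynomial.order x p)"
  shows "even (degree p)"
  using assms
proof (induction "degree p" arbitrary: p rule: less_induct)
  case less
  show ?case
  proof (cases "degree p = 0")
    case False
    then obtain a where a: "poly p a = 0"
      using alg_closed_imp_poly_has_root[of p] by auto
    define k where "k = Polynomial.order a p"
    have "k > 0" using a less.prems by (simp add: k_def order_gt_0_iff)
    obtain q where q: "p = [:- a, 1:] ^ k * q" "\<not> [:- a, 1:] dvd q"
      using order_decomp[OF less.prems(1), of a] unfolding k_def by blast
    have "q \<noteq> 0" using q less.prems by auto
    have deg: "degree p = k + degree q"
      using q \<open>q \<noteq> 0\<close> by (simp add: degree_mult_eq degree_power_eq)
    have "even (Polynomial.order x q)" for x
    proof (cases "x = a")
      case True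
      then have "Polynomial.order x q = 0"
        using q(2) by (intro order_0I) (simp add: poly_eq_0_iff_dvd)
      then show ?thesis by simp
    next
      case False
      then have "Polynomial.order x ([:- a, 1:] ^ k) = 0"
        by (intro order_0I) simp
      then have "Polynomial.order x p = Polynomial.order x q"
        using less.prems(1) q(1) by (simp add: order_mult)
      then show ?thesis using less.prems(2)[of x] by simp
    qed
    then have "even (degree q)"
      using less.hyps[of q] deg \<open>k > 0\<close> \<open>q \<noteq> 0\<close> by simp
    moreover have "even k" using less.prems(2) by (simp add: k_def)
    ultimately show ?thesis using deg by simp
  qed simp
qed

lemma to_ac_hom: "unital_ring_hom to_ac"
  by unfold_locales simp_all

text \<open>
  The degree is the sum of the orders at the roots in the algebraic closure, so one of them is odd.
  Using the order at such a root, rather than the multiplicity of an irreducible factor of \<open>m\<close>,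
  keeps the argument free of unique factorization in \<open>k[t]\<close>.
\<close>

lemma odd_valuation_exists:
  fixes m :: "'a::field poly"
  assumes "odd (degree m)"
  obtains v :: "'a poly \<Rightarrow> nat" where "nat_valuation v" "odd (v m)"
proof -
  interpret unital_ring_hom "to_ac :: 'a \<Rightarrow> _" by (rule to_ac_hom)
  have eq_0_iff: "map_poly to_ac p = 0 \<longleftrightarrow> p = 0" for p :: "'a poly"
    by (rule map_poly_eq_0_iff) auto
  have "degree (map_poly to_ac m) = degree m"
    by (rule degree_map_poly) auto
  moreover have "m \<noteq> 0" using assms by auto
  ultimately obtain x where x: "odd (Polynomial.order x (map_poly to_ac m))"
    using even_orders_imp_even_degree[of "map_poly to_ac m"] assms eq_0_iff by auto
  have "nat_valuation (\<lambda>p :: 'a poly. Polynomial.order x (map_poly to_ac p))"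
  proof
    fix a b :: "'a poly" assume ab: "a \<noteq> 0" "b \<noteq> 0"
    show "Polynomial.order x (map_poly to_ac (a * b)) =
        Polynomial.order x (map_poly to_ac a) + Polynomial.order x (map_poly to_ac b)"
      using ab by (simp add: map_poly_mult order_mult eq_0_iff)
    assume "a + b \<noteq> 0"
    then have "map_poly to_ac a + map_poly to_ac b \<noteq> 0"
      using eq_0_iff[of "a + b"] by (simp add: map_poly_add)
    define k where "k = min (Polynomial.order x (map_poly to_ac a)) (Polynomial.order x (map_poly to_ac b))"
    have "[:- x, 1:] ^ k dvd map_poly to_ac a + map_poly to_ac b"
      by (intro dvd_add) (simp_all add: order_divides k_def)
    then show "k \<le> Polynomial.order x (map_poly to_ac (a + b))"
      using \<open>map_poly to_ac a + map_poly to_ac b \<noteq> 0\<close> by (simp add: order_divides map_poly_add)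
  qed
  then show thesis using x by (rule that)
qed

section \<open>Irreducibility of \<open>Q\<^sub>n\<close> over the rational function field\<close>

lemma critical_orbit_Suc:
  "poly (iterate_poly [:m, 0, 1:] (Suc n)) 0 = poly (iterate_poly [:m, 0, 1:] n) 0 ^ 2 + m"
  by (simp add: iterate_poly_Suc poly_pcompose power2_eq_square add.commute)

lemma degree_critical_orbit:
  fixes m :: "'a::idom poly"
  assumes "degree m > 0"
  shows "degree (poly (iterate_poly [:m, 0, 1:] (Suc n)) 0) = 2 ^ n * degree m"
proof (induction n)
  case 0
  then show ?case by (simp add: iterate_poly_Suc poly_pcompose)
next
  case (Suc n)
  define c where "c = poly (iterate_poly [:m, 0, 1:] (Suc n)) 0"
  have c: "degree c = 2 ^ n * degree m"
    unfolding c_def by (rule Suc)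
  then have "c \<noteq> 0" using assms by auto
  then have "degree (c ^ 2) = 2 ^ Suc n * degree m"
    by (simp add: degree_power_eq c)
  moreover have "degree m < 2 ^ Suc n * degree m"
    using assms one_less_power[of "2::nat" "Suc n"] by simp
  ultimately show ?case
    by (subst critical_orbit_Suc) (simp add: degree_add_eq_left c_def[symmetric])
qed

text \<open>
  With \<open>c\<^sub>j = \<phi>\<^sup>j(0) = m^(2^(j-1)) + r\<^sub>j\<close>, the recursion \<open>c\<^sub>j\<^sub>+\<^sub>1 = c\<^sub>j\<^sup>2 + m\<close> shows that \<open>r\<^sub>j\<^sub>+\<^sub>1\<close> is
  dominated by the cross term \<open>2 * m^(2^(j-1)) * r\<^sub>j\<close>. For the iterate that
  defines \<open>\<gamma>\<close> this difference is \<open>- \<gamma>\<close>, and its degree is odd when that of \<open>m\<close> is.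
\<close>

lemma degree_critical_orbit_minus_power:
  fixes m :: "'a::idom poly"
  assumes "degree m > 0" and two: "(2 :: 'a) \<noteq> 0"
  shows "degree (poly (iterate_poly [:m, 0, 1:] (n + 2)) 0 - m ^ 2 ^ (n + 1)) = (2 ^ (n + 1) - 1) * degree m"
proof (induction n)
  case 0
  then show ?case by (simp add: numeral_2_eq_2 iterate_poly_Suc poly_pcompose)
next
  case (Suc n)
  define r where "r = poly (iterate_poly [:m, 0, 1:] (n + 2)) 0 - m ^ 2 ^ (n + 1)"
  define D where "D = degree m"
  define k where "k = (2 :: nat) ^ (n + 1)"
  have k: "k \<ge> 2" by (simp add: k_def)
  have "D > 0" using assms by (simp add: D_def)
  have "m \<noteq> 0" using assms by auto
  have r: "degree r = (k - 1) * D"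
    unfolding r_def k_def D_def by (rule Suc)
  then have "r \<noteq> 0" using k \<open>D > 0\<close> by auto
  have "(2 :: 'a poly) \<noteq> 0" using two by (metis of_nat_numeral of_nat_poly pCons_eq_0_iff)
  have two': "2 = [:2 :: 'a:]" by (simp add: numeral_poly)
  have "poly (iterate_poly [:m, 0, 1:] (Suc n + 2)) 0 = (m ^ k + r) ^ 2 + m"
    using critical_orbit_Suc[of m "n + 2"] by (simp add: r_def k_def)
  also have "\<dots> = m ^ 2 ^ (Suc n + 1) + (2 * m ^ k * r + (r ^ 2 + m))"
    by (simp add: power2_eq_square algebra_simps k_def mult_2_right[symmetric] power_add[symmetric])
  finally have "poly (iterate_poly [:m, 0, 1:] (Suc n + 2)) 0 - m ^ 2 ^ (Suc n + 1) =
      2 * m ^ k * r + (r ^ 2 + m)" by simp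
  also have "degree \<dots> = (2 ^ (Suc n + 1) - 1) * degree m"
  proof -
    have main: "degree (2 * m ^ k * r) = (2 * k - 1) * D"
      using \<open>m \<noteq> 0\<close> \<open>r \<noteq> 0\<close> two k unfolding two'
      by (simp add: degree_mult_eq degree_power_eq r D_def algebra_simps diff_mult_distrib)
    have "degree (r ^ 2) < (2 * k - 1) * D"
      using \<open>r \<noteq> 0\<close> k \<open>D > 0\<close> by (simp add: degree_power_eq r)
    moreover have "degree m < (2 * k - 1) * D"
      using k \<open>D > 0\<close> by (simp add: D_def)
    ultimately have "degree (r ^ 2 + m) < degree (2 * m ^ k * r)"
      unfolding main by (intro degree_add_less)
    then have "degree (2 * m ^ k * r + (r ^ 2 + m)) = (2 * k - 1) * D"
      by (simp only: degree_add_eq_left main)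
    then show ?thesis by (simp add: k_def D_def)
  qed
  finally show ?case .
qed

text \<open>
  Modulo \<open>m\<^sup>2\<close> the iterate is known well enough to read off the edge of the Newton polygon: below
  degree \<open>2^(n+2)\<close> all coefficients are divisible by \<open>m\<close>, the one of degree \<open>2^(n+1)\<close> is
  \<open>2 * m\<close> modulo \<open>m\<^sup>2\<close>, and those of smaller positive degree are divisible by \<open>m\<^sup>2\<close>. The last two
  facts are where \<open>A(0) = 1\<close> and the monomial in front of \<open>A\<close> enter.
\<close>

lemma iterate_quadratic_mod_square:
  fixes m :: "'r::comm_ring_1"
  shows "\<exists>A B. iterate_poly [:m, 0, 1:] (n + 2) =
    Polynomial.monom 1 (2 ^ (n + 2)) +
    Polynomial.smult m (Polynomial.smult 2 (Polynomial.monom 1 (2 ^ (n + 1)) * A) + 1) +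
    Polynomial.smult (m ^ 2) B \<and> Polynomial.coeff A 0 = 1"
proof (induction n)
  case 0
  have "iterate_poly [:m, 0, 1:] (0 + 2) =
    Polynomial.monom 1 4 + Polynomial.smult m (Polynomial.smult 2 (Polynomial.monom 1 2 * 1) + 1) +
    Polynomial.smult (m ^ 2) 1"
    by (simp add: numeral_2_eq_2 iterate_poly_Suc pcompose_pCons monom_altdef power2_eq_square
        one_pCons eval_nat_numeral algebra_simps)
  then show ?case
    by (intro exI[of _ 1]) (simp del: add_0)
next
  case (Suc n)
  define Y where "Y k = (Polynomial.monom 1 k :: 'r poly)" for k
  have YY: "Y k * Y k = Y (2 * k)" for k
    by (simp add: Y_def mult_monom mult_2)
  obtain A B where AB: "iterate_poly [:m, 0, 1:] (n + 2) =
      Y (2 ^ (n + 2)) + Polynomial.smult m (Polynomial.smult 2 (Y (2 ^ (n + 1)) * A) + 1) +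
      Polynomial.smult (m ^ 2) B" "Polynomial.coeff A 0 = 1"
    unfolding Y_def using Suc by blast
  define A' where "A' = Polynomial.smult 2 (Y (2 ^ (n + 1)) * A) + 1"
  define Y' where "Y' = Y (2 ^ (n + 2))"
  have Y': "Y' * Y' = Y (2 ^ (n + 3))"
    using YY[of "2 ^ (n + 2)"] by (simp add: Y'_def eval_nat_numeral)
  have "iterate_poly [:m, 0, 1:] (Suc n + 2) = iterate_poly [:m, 0, 1:] (n + 2) ^ 2 + [:m:]"
    by (simp add: iterate_poly_Suc pcompose_pCons power2_eq_square)
  also have "iterate_poly [:m, 0, 1:] (n + 2) = Y' + [:m:] * A' + [:m:] ^ 2 * B"
    using AB(1) by (simp add: A'_def Y'_def power2_eq_square)
  also have "(Y' + [:m:] * A' + [:m:] ^ 2 * B) ^ 2 + [:m:] =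
      Y' * Y' + [:m:] * (2 * (Y' * A') + 1) +
      [:m:] ^ 2 * (A' ^ 2 + 2 * Y' * B + 2 * [:m:] * A' * B + [:m:] ^ 2 * B ^ 2)"
    by (simp only: power2_eq_square) (simp only: algebra_simps mult_2 mult_1)
  also have "\<dots> = Y (2 ^ (Suc n + 2)) + Polynomial.smult m (Polynomial.smult 2 (Y (2 ^ (Suc n + 1)) * A') + 1) +
      Polynomial.smult (m ^ 2) (A' ^ 2 + 2 * Y' * B + 2 * [:m:] * A' * B + [:m:] ^ 2 * B ^ 2)"
    unfolding Y' unfolding Y'_def by (simp add: numeral_poly power2_eq_square eval_nat_numeral)
  finally show ?case
    unfolding Y_def[symmetric]
  proof (intro exI conjI)
    show "Polynomial.coeff A' 0 = 1"
      by (simp add: A'_def Y_def coeff_monom_mult)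
  qed
qed

text \<open>
  The constant terms of \<open>Q\<^sub>1, \<dots>, Q\<^sub>n\<^sub>-\<^sub>1\<close> have odd degree, so neither they nor their negatives are
  squares, and \<open>Q\<^sub>n\<^sub>-\<^sub>1\<close> is irreducible. For the last step the
  constant term \<open>m^N\<close> is a square, and the Newton polygon decides. There \<open>n \<ge> 3\<close> is used in the
  form \<open>N > 2\<close>: it puts the point of the constant term strictly above the line through the edge of
  length \<open>N\<close> and height \<open>v m\<close>.
\<close>

lemma iterate_quadratic_irreducible_fract:
  fixes m \<gamma> :: "'a::field poly"
  assumes two: "(2 :: 'a) \<noteq> 0" and n: "n \<ge> 3" and odd: "odd (degree m)"
    and \<gamma>: "\<gamma> = m ^ (2 ^ (n - 1)) - poly (iterate_poly [:m, 0, 1:] n) 0"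
  shows "irreducible (fract_poly (iterate_poly [:m, 0, 1:] n + [:\<gamma>:]))"
proof -
  interpret F: unital_ring_hom "to_fract :: 'a poly \<Rightarrow> _"
    by unfold_locales simp_all
  define M where "M = to_fract m"
  define \<Gamma> where "\<Gamma> = to_fract \<gamma>"
  define Q where "Q j = iterate_poly [:m, 0, 1:] j + [:\<gamma>:]" for j
  have fract_Q: "fract_poly (Q j) = iterate_poly [:M, 0, 1:] j + [:\<Gamma>:]" for j
    by (simp add: Q_def F.map_poly_iterate_poly F.map_poly_pCons' M_def \<Gamma>_def)
  have D: "degree m > 0" using odd by (cases "degree m") auto
  define N where "N = (2 :: nat) ^ (n - 1)"
  have N4: "N \<ge> 4"
    using power_increasing[of 2 "n - 1" "2::nat"] n by (simp add: N_def)
  have two_N: "2 ^ n = 2 * N"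
    using n by (cases n) (simp_all add: N_def)
  have "even N" using n by (simp add: N_def)
  have \<gamma>_deg: "degree \<gamma> = (N - 1) * degree m"
  proof -
    have "degree \<gamma> = degree (poly (iterate_poly [:m, 0, 1:] (n - 2 + 2)) 0 - m ^ 2 ^ (n - 2 + 1))"
      using n degree_minus[of \<gamma>] by (simp add: \<gamma> Suc_diff_Suc numeral_2_eq_2)
    also have "\<dots> = (2 ^ (n - 2 + 1) - 1) * degree m"
      by (rule degree_critical_orbit_minus_power[OF D two])
    also have "n - 2 + 1 = n - 1" using n by simp
    finally show ?thesis by (simp only: N_def)
  qed
  have Q_0: "poly (Q j) 0 = poly (iterate_poly [:m, 0, 1:] j) 0 + \<gamma>" for j
    by (simp add: Q_def)
  have Q_0_deg: "degree (poly (Q (Suc i)) 0) = (N - 1) * degree m" if "i < n - 1" for i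
  proof -
    have "(2 :: nat) ^ i \<le> 2 ^ (n - 2)"
      using that by (intro power_increasing) auto
    moreover have "2 * 2 ^ (n - 2) = N"
      using n power_Suc[of "2::nat" "n - 2"] by (simp add: N_def Suc_diff_Suc numeral_2_eq_2)
    ultimately have "2 ^ i < N - 1" using N4 by linarith
    then have "2 ^ i * degree m < (N - 1) * degree m"
      using D by simp
    then show ?thesis
      unfolding Q_0 using degree_critical_orbit[OF D, of i] \<gamma>_deg by (simp add: degree_add_eq_right)
  qed
  have "odd ((N - 1) * degree m)"
    using \<open>even N\<close> N4 odd by simp
  have irr: "irreducible (fract_poly (Q (n - 1)))"
    unfolding fract_Q
  proof (rule iterate_quadratic_irreducible)
    fix i z assume "i < n - 1"
    have eq: "poly (iterate_poly [:M, 0, 1:] (Suc i) + [:\<Gamma>:]) 0 = to_fract (poly (Q (Suc i)) 0)"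
      using F.poly_map_poly[of "Q (Suc i)" 0] by (simp only: fract_Q F.zero)
    show "z ^ 2 \<noteq> poly (iterate_poly [:M, 0, 1:] (Suc i) + [:\<Gamma>:]) 0"
      unfolding eq using Q_0_deg[OF \<open>i < n - 1\<close>] \<open>odd ((N - 1) * degree m)\<close>
      by (intro odd_degree_not_square_fract) simp
    show "z ^ 2 \<noteq> - poly (iterate_poly [:M, 0, 1:] (Suc i) + [:\<Gamma>:]) 0"
      unfolding eq to_fract_uminus[symmetric] using Q_0_deg[OF \<open>i < n - 1\<close>] \<open>odd ((N - 1) * degree m)\<close>
      by (intro odd_degree_not_square_fract) (simp only: degree_minus not_False_eq_True)
  qed
  have step: "fract_poly (Q n) = pcompose (fract_poly (Q (n - 1))) [:M, 0, 1:]"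
    using iterate_quadratic_plus_Suc[of M "n - 1" \<Gamma>] n by (simp add: fract_Q)
  have "irreducible (fract_poly (Q n))"
  proof (rule ccontr)
    assume "\<not> irreducible (fract_poly (Q n))"
    then obtain h where h: "h * pcompose h [:0, -1:] = smult ((-1) ^ 2 ^ (n - 1)) (fract_poly (Q n))"
      using reducible_pcompose_quadratic[OF irr, of M] lead_coeff_iterate_quadratic_plus[of M "n - 1" \<Gamma>]
        degree_iterate_quadratic_plus[of M "n - 1" \<Gamma>]
      unfolding step by (metis fract_Q)
    then have h: "h * pcompose h [:0, -1:] = fract_poly (Q n)"
      using \<open>even N\<close> by (simp add: N_def)
    obtain s H where sH: "s \<noteq> 0" "smult (to_fract s) h = fract_poly H"
      by (rule clear_denominators)
    have "fract_poly (H * pcompose H [:0, -1:]) = fract_poly H * pcompose (fract_poly H) [:0, -1:]"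
      by (simp add: F.map_poly_pcompose F.map_poly_pCons' F.uminus)
    also have "\<dots> = fract_poly (smult (s ^ 2) (Q n))"
      by (simp add: sH(2)[symmetric] pcompose_smult h F.power power2_eq_square)
    finally have H: "H * pcompose H [:0, -1:] = smult (s ^ 2) (Q n)"
      by (simp only: fract_poly_eq_iff)
    obtain v :: "'a poly \<Rightarrow> nat" where v: "nat_valuation v" "odd (v m)"
      using odd by (rule odd_valuation_exists)
    interpret nat_valuation v by fact
    define e where "e = v m"
    have "e > 0" using v by (cases "v m") (auto simp: e_def)
    have "m \<noteq> 0" using D by auto
    obtain A B where AB: "iterate_poly [:m, 0, 1:] n =
        Polynomial.monom 1 (2 * N) + Polynomial.smult m (Polynomial.smult 2 (Polynomial.monom 1 N * A) + 1) +
        Polynomial.smult (m ^ 2) B" "Polynomial.coeff A 0 = 1"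
      using iterate_quadratic_mod_square[of m "n - 2"] n two_N
      by (auto simp: N_def numeral_2_eq_2 Suc_diff_Suc)
    have coeff: "Polynomial.coeff (Q n) i = (if i = 2 * N then 1 else 0) +
        m * ((if i < N then 0 else 2 * Polynomial.coeff A (i - N)) + m * Polynomial.coeff B i)" if "i > 0" for i
    proof -
      obtain i' where "i = Suc i'" using \<open>i > 0\<close> gr0_implies_Suc by blast
      then show ?thesis
        by (simp add: Q_def AB(1) coeff_monom_mult power2_eq_square distrib_left mult.assoc mult.left_commute)
    qed
    have two_unit: "(2 :: 'a poly) dvd 1"
      using two by (simp add: numeral_poly is_unit_const_poly_iff dvd_field_iff)
    have v_mid: "2 + m * b \<noteq> 0 \<and> v (2 + m * b) = 0" for b
    proof -
      have "(2 :: 'a poly) \<noteq> 0" "v 2 = 0"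
        using two_unit v_unit by auto
      moreover have "m * b = 0 \<or> 0 < v (m * b)"
        using \<open>e > 0\<close> \<open>m \<noteq> 0\<close> by (cases "b = 0") (auto simp: v_mult e_def)
      ultimately show ?thesis
        using v_add_dominated[of 2 "m * b"] by auto
    qed
    have "H * pcompose H [:0, -1:] \<noteq> smult (s ^ 2) (Q n)"
    proof (rule twisted_square_newton_polygon)
      show "N > 0" using N4 by simp
      show "odd e" using v by (simp add: e_def)
      show "degree (Q n) = 2 * N"
        by (simp add: Q_def degree_iterate_quadratic_plus two_N)
      show "lead_coeff (Q n) = 1"
        unfolding Q_def by (rule lead_coeff_iterate_quadratic_plus)
      have mid: "Polynomial.coeff (Q n) N = m * (2 + m * Polynomial.coeff B N)"
        using N4 coeff[of N] AB(2) by simp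
      show "Polynomial.coeff (Q n) N \<noteq> 0" "v (Polynomial.coeff (Q n) N) = e"
        unfolding mid using v_mid \<open>m \<noteq> 0\<close> by (simp_all add: v_mult e_def)
      fix i assume i: "i \<noteq> N" "i \<noteq> 2 * N" "Polynomial.coeff (Q n) i \<noteq> 0"
      show "2 * e * N < N * v (Polynomial.coeff (Q n) i) + e * i"
      proof (cases "i = 0")
        case True
        have "Polynomial.coeff (Q n) i = m ^ N"
          using Q_0[of n] True by (simp add: \<gamma> N_def poly_0_coeff_0)
        then have v_i: "v (Polynomial.coeff (Q n) i) = N * e"
          using \<open>m \<noteq> 0\<close> by (simp add: v_power e_def)
        have "2 * e * N < N * (N * e)"
          using N4 \<open>e > 0\<close> by simp
        then show ?thesis unfolding v_i by linarith
      next
        case False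
        then have *: "Polynomial.coeff (Q n) i =
            m * ((if i < N then 0 else 2 * Polynomial.coeff A (i - N)) + m * Polynomial.coeff B i)"
          using coeff[of i] i by simp
        show ?thesis
        proof (cases "i < N")
          case True
          then have "m ^ 2 dvd Polynomial.coeff (Q n) i"
            using * by (simp add: power2_eq_square)
          then have "2 * e \<le> v (Polynomial.coeff (Q n) i)"
            using v_dvd[of "m ^ 2"] i \<open>m \<noteq> 0\<close> by (auto simp: v_power e_def)
          then have "N * (2 * e) \<le> N * v (Polynomial.coeff (Q n) i)" by (rule mult_le_mono2)
          moreover have "e * i > 0" using False \<open>e > 0\<close> by simp
          moreover have "2 * e * N = N * (2 * e)" by simp
          ultimately show ?thesis by linarith
        next
          case False
          have "m dvd Polynomial.coeff (Q n) i"
            unfolding * by simp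
          then have "e \<le> v (Polynomial.coeff (Q n) i)"
            using v_dvd[of m] i by (auto simp: e_def)
          then have "N * e \<le> N * v (Polynomial.coeff (Q n) i)" by (rule mult_le_mono2)
          moreover have "e * N < e * i" using False i \<open>e > 0\<close> by simp
          moreover have "2 * e * N = N * e + e * N" by simp
          ultimately show ?thesis by linarith
        qed
      qed
    qed fact
    then show False using H by contradiction
  qed
  then show ?thesis by (simp add: Q_def)
qed

section \<open>Polynomials over a quotient by a prime ideal\<close>

lemma ring_of_type_algebra_simps [simp]:
  "carrier ring_of_type_algebra = UNIV"
  "x \<otimes>\<^bsub>ring_of_type_algebra\<^esub> y = x * y"
  "x \<oplus>\<^bsub>ring_of_type_algebra\<^esub> y = x + y"
  "\<one>\<^bsub>ring_of_type_algebra\<^esub> = 1"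
  "\<zero>\<^bsub>ring_of_type_algebra\<^esub> = 0"
  by (simp_all add: ring_of_type_algebra_def)

lemma minus_ring_of_type_algebra:
  fixes x y :: "'r::comm_ring_1"
  shows "x \<ominus>\<^bsub>ring_of_type_algebra\<^esub> y = x - y"
proof -
  interpret R: ring "ring_of_type_algebra :: 'r ring" by (rule ring_from_type_algebra)
  have "\<ominus>\<^bsub>ring_of_type_algebra\<^esub> y = - y"
    by (rule R.minus_equality) simp_all
  then show ?thesis by (simp add: a_minus_def)
qed

lemma finsum_ring_of_type_algebra:
  fixes f :: "'i \<Rightarrow> 'r::comm_ring_1"
  assumes "finite S"
  shows "finsum ring_of_type_algebra f S = sum f S"
proof -
  interpret R: ring "ring_of_type_algebra :: 'r ring" by (rule ring_from_type_algebra)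
  show ?thesis using assms
    by (induction S rule: finite_induct) (simp_all add: R.finsum_insert)
qed

text \<open>
  A homomorphism to a field with kernel \<open>P\<close> embeds \<open>R/P\<close>. It turns statements about polynomials
  whose coefficients are cosets into statements about polynomials over a field type, where degrees
  and factorizations are easier to handle.
\<close>

locale prime_quotient =
  fixes P :: "'r::comm_ring_1 set" and ev :: "'r \<Rightarrow> 'b::field"
  assumes prime: "primeideal P (ring_of_type_algebra :: 'r ring)"
    and ev_hom: "unital_ring_hom ev"
    and kernel: "a \<in> P \<longleftrightarrow> ev a = 0"
begin

abbreviation R :: "'r ring" where "R \<equiv> ring_of_type_algebra"
abbreviation S :: "'r set ring" where "S \<equiv> R Quot P"

sublocale unital_ring_hom ev by (rule ev_hom)
sublocale primeideal P R by (rule prime)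
sublocale proj: ring_hom_cring R S "(+>\<^bsub>R\<^esub>) P" by (rule rcos_ring_hom_cring)
sublocale S: domain S by (rule quotient_is_domain)

lemma coset_eq_iff: "P +>\<^bsub>R\<^esub> a = P +>\<^bsub>R\<^esub> b \<longleftrightarrow> ev a = ev b"
  using quotient_eq_iff_same_a_r_cos[OF is_ideal, of a b]
  by (simp add: minus_ring_of_type_algebra kernel diff)

lemma coset_zero: "P +>\<^bsub>R\<^esub> 0 = \<zero>\<^bsub>S\<^esub>"
  using proj.hom_zero by simp

lemma coset_closed: "P +>\<^bsub>R\<^esub> a \<in> carrier S"
  by (rule proj.hom_closed) simp

lemma reduce_poly_closed: "reduce_poly P p \<in> carrier (UP S)"
proof -
  have "bound \<zero>\<^bsub>S\<^esub> (degree p) (reduce_poly P p)"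
    by (rule bound.intro) (simp only: reduce_poly_def coeff_eq_0 coset_zero)
  then have "reduce_poly P p \<in> up S"
    using coset_closed unfolding reduce_poly_def by (intro mem_upI exI)
  then show ?thesis by (simp add: UP_def)
qed

lemma reduce_poly_eq_iff: "reduce_poly P p = reduce_poly P q \<longleftrightarrow> map_poly ev p = map_poly ev q"
  by (auto simp: reduce_poly_def fun_eq_iff coset_eq_iff poly_eq_iff coeff_map_poly)

lemma reduce_poly_mult: "reduce_poly P (p * q) = reduce_poly P p \<otimes>\<^bsub>UP S\<^esub> reduce_poly P q"
proof -
  have up: "reduce_poly P p \<in> up S" for p
    using reduce_poly_closed[of p] by (simp add: UP_def)
  have "reduce_poly P (p * q) n =
      (\<Oplus>\<^bsub>S\<^esub>i\<in>{..n}. reduce_poly P p i \<otimes>\<^bsub>S\<^esub> reduce_poly P q (n - i))" for n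
  proof -
    have "reduce_poly P (p * q) n =
        P +>\<^bsub>R\<^esub> finsum R (\<lambda>i. Polynomial.coeff p i * Polynomial.coeff q (n - i)) {..n}"
      by (simp add: reduce_poly_def coeff_mult finsum_ring_of_type_algebra)
    also have "\<dots> = finsum S ((+>\<^bsub>R\<^esub>) P \<circ> (\<lambda>i. Polynomial.coeff p i * Polynomial.coeff q (n - i))) {..n}"
      by (rule proj.hom_finsum) simp
    also have "\<dots> = (\<Oplus>\<^bsub>S\<^esub>i\<in>{..n}. reduce_poly P p i \<otimes>\<^bsub>S\<^esub> reduce_poly P q (n - i))"
      using proj.hom_mult coset_closed by (intro proj.S.finsum_cong') (auto simp: reduce_poly_def)
    finally show ?thesis .
  qed
  then show ?thesis using up by (simp add: UP_def fun_eq_iff)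
qed

lemma reduce_poly_one: "reduce_poly P 1 = \<one>\<^bsub>UP S\<^esub>"
  using proj.hom_one by (simp add: UP_def reduce_poly_def fun_eq_iff coset_zero)

lemma reduce_poly_zero: "reduce_poly P 0 = \<zero>\<^bsub>UP S\<^esub>"
  by (simp add: UP_def reduce_poly_def coset_zero)

lemma reduce_poly_surj:
  assumes "Y \<in> carrier (UP S)"
  obtains p where "Y = reduce_poly P p"
proof -
  have Y: "\<And>i. Y i \<in> carrier S" "\<exists>n. bound \<zero>\<^bsub>S\<^esub> n Y"
    using assms by (auto simp: UP_def up_def)
  then obtain n where n: "\<And>i. i > n \<Longrightarrow> Y i = \<zero>\<^bsub>S\<^esub>"
    by blast
  have "\<exists>a. Y i = P +>\<^bsub>R\<^esub> a" for i
    using Y(1)[of i] by (auto simp: FactRing_def A_RCOSETS_def' a_r_coset_def')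
  then obtain a where a: "\<And>i. Y i = P +>\<^bsub>R\<^esub> a i"
    by metis
  define p where "p = (\<Sum>i\<le>n. Polynomial.monom (a i) i)"
  have "Polynomial.coeff p i = (if i \<le> n then a i else 0)" for i
    by (simp add: p_def coeff_sum)
  then have "Y = reduce_poly P p"
    using a n by (auto simp: reduce_poly_def fun_eq_iff not_le coset_zero)
  then show thesis by (rule that)
qed

text \<open>
  An inverse lifts to a polynomial over \<open>R\<close>, whose image under \<open>ev\<close> is an inverse over a field.
\<close>

lemma degree_eq_0_if_unit:
  assumes "reduce_poly P p \<in> Units (UP S)"
  shows "degree (map_poly ev p) = 0"
proof -
  obtain Y where "Y \<in> carrier (UP S)" "reduce_poly P p \<otimes>\<^bsub>UP S\<^esub> Y = \<one>\<^bsub>UP S\<^esub>"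
    using assms unfolding Units_def by blast
  then obtain q where "reduce_poly P (p * q) = reduce_poly P 1"
    by (metis reduce_poly_mult reduce_poly_one reduce_poly_surj)
  then have "map_poly ev p * map_poly ev q = 1"
    by (simp add: reduce_poly_eq_iff map_poly_mult one)
  then have "map_poly ev p dvd 1" by (metis dvdI)
  then show ?thesis by (auto elim!: is_unit_polyE)
qed

lemma ring_reducible_reduce_poly:
  assumes "map_poly ev g = map_poly ev a * map_poly ev b"
    and "degree (map_poly ev a) > 0" "degree (map_poly ev b) > 0"
  shows "ring_reducible (UP S) (reduce_poly P g)"
proof -
  have "map_poly ev a \<noteq> 0" "map_poly ev b \<noteq> 0" using assms by auto
  then have deg: "degree (map_poly ev g) > 0"
    using assms by (simp add: degree_mult_eq)
  have domain_UP: "domain (UP S)"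
    by (intro UP_domain.UP_domain UP_domain.intro S.domain_axioms)
  have "reduce_poly P g \<noteq> \<zero>\<^bsub>UP S\<^esub>"
    using deg by (auto simp: reduce_poly_zero[symmetric] reduce_poly_eq_iff)
  moreover have "reduce_poly P g \<notin> Units (UP S)"
    using deg degree_eq_0_if_unit by force
  moreover have "\<not> ring_irreducible\<^bsub>UP S\<^esub> (reduce_poly P g)"
  proof
    assume irr: "ring_irreducible\<^bsub>UP S\<^esub> (reduce_poly P g)"
    have "reduce_poly P g = reduce_poly P a \<otimes>\<^bsub>UP S\<^esub> reduce_poly P b"
      using assms(1) by (simp add: reduce_poly_mult[symmetric] reduce_poly_eq_iff map_poly_mult)
    then have "reduce_poly P a \<in> Units (UP S) \<or> reduce_poly P b \<in> Units (UP S)"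
      using domain.ring_irreducibleE(5)[OF domain_UP reduce_poly_closed irr] reduce_poly_closed
      by blast
    then show False using assms degree_eq_0_if_unit by force
  qed
  ultimately show ?thesis
    by (simp add: ring_reducible_def reduce_poly_closed)
qed

end

section \<open>Residue fields of \<open>k[t]\<close> inside the algebraic closure of \<open>k\<close>\<close>

lemma poly_ideal_generator:
  fixes I :: "'a::field poly set"
  assumes "\<And>p q. p \<in> I \<Longrightarrow> q \<in> I \<Longrightarrow> p - q \<in> I" "\<And>p q. p \<in> I \<Longrightarrow> q * p \<in> I"
    and "x \<in> I" "x \<noteq> 0"
  obtains g where "g \<in> I" "g \<noteq> 0" "\<And>p. p \<in> I \<Longrightarrow> g dvd p"
proof -
  obtain g where "(g \<in> I \<and> g \<noteq> 0) \<and> (\<forall>p. p \<in> I \<and> p \<noteq> 0 \<longrightarrow> degree g \<le> degree p)"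
    using ex_has_least_nat[of "\<lambda>p. p \<in> I \<and> p \<noteq> 0" x degree] assms(3,4) by auto
  then have g: "g \<in> I" "g \<noteq> 0" "\<And>p. p \<in> I \<Longrightarrow> p \<noteq> 0 \<Longrightarrow> degree g \<le> degree p"
    by simp_all
  have "g dvd p" if "p \<in> I" for p
  proof (rule ccontr)
    assume "\<not> g dvd p"
    then have "p mod g \<noteq> 0" by (simp add: dvd_eq_mod_eq_0)
    moreover have "p mod g \<in> I"
      using assms(1)[OF that assms(2)[OF g(1), of "p div g"]] by (simp add: minus_div_mult_eq_mod)
    ultimately have "degree g \<le> degree (p mod g)" by (rule g(3)[rotated])
    then show False
      using degree_mod_less[OF g(2), of p] \<open>p mod g \<noteq> 0\<close> by simp
  qed
  then show thesis using g that by blast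
qed

text \<open>
  Take for \<open>\<theta>\<close> a root of a generator \<open>g\<close> of \<open>P\<close>. The kernel of evaluation at \<open>\<theta>\<close> contains
  \<open>P\<close>; its generator \<open>r\<close> divides \<open>g\<close>, so primality puts \<open>r\<close> or the cofactor into \<open>P\<close>, and the
  cofactor has too small a degree.
\<close>

lemma prime_ideal_kernel_of_evaluation:
  fixes P :: "'a::field poly set"
  assumes "primeideal P (ring_of_type_algebra :: 'a poly ring)" and "P \<noteq> {0}"
  obtains \<theta> :: "'a alg_closure" where "\<And>p. p \<in> P \<longleftrightarrow> poly (map_poly to_ac p) \<theta> = 0"
proof -
  interpret primeideal P "ring_of_type_algebra :: 'a poly ring" by fact
  interpret unital_ring_hom "to_ac :: 'a \<Rightarrow> _" by (rule to_ac_hom)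
  have mult_closed: "q * p \<in> P" if "p \<in> P" for p q
    using I_l_closed[OF that, of q] by simp
  have diff_closed: "p - q \<in> P" if "p \<in> P" "q \<in> P" for p q
    using additive_subgroup.a_closed[OF additive_subgroup_axioms that(1) mult_closed[OF that(2), of "- 1"]] by simp
  have "0 \<in> P"
    using additive_subgroup.zero_closed[OF additive_subgroup_axioms] by simp
  then obtain x where x: "x \<in> P" "x \<noteq> 0" using assms(2) by blast
  obtain g where g: "g \<in> P" "g \<noteq> 0" "\<And>p. p \<in> P \<Longrightarrow> g dvd p"
  proof (rule poly_ideal_generator[of P x])
    show "x \<in> P" "x \<noteq> 0" by (fact x)+
  qed (simp_all add: diff_closed mult_closed)
  have "1 \<notin> P"
    using I_notcarr one_imp_carrier by auto
  have "degree g > 0"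
  proof (rule ccontr)
    assume "\<not> degree g > 0"
    then have "g dvd 1" using g(2) by (simp add: is_unit_iff_degree)
    then show False using \<open>1 \<notin> P\<close> mult_closed[OF g(1)] by (metis dvdE mult.commute)
  qed
  then have "degree (map_poly to_ac g) > 0"
    by (subst degree_map_poly) auto
  then obtain \<theta> where \<theta>: "poly (map_poly to_ac g) \<theta> = 0"
    using alg_closed_imp_poly_has_root by blast
  define I where "I = {p. poly (map_poly to_ac p) \<theta> = 0}"
  interpret mp: unital_ring_hom "map_poly (to_ac :: 'a \<Rightarrow> _)" by (rule map_poly_hom)
  have "P \<subseteq> I"
  proof
    fix p assume "p \<in> P"
    then obtain q where "p = g * q" using g(3) by (meson dvdE)
    then show "p \<in> I" using \<theta> by (simp add: I_def mp.mult)
  qed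
  obtain r where r: "r \<in> I" "r \<noteq> 0" "\<And>p. p \<in> I \<Longrightarrow> r dvd p"
  proof (rule poly_ideal_generator[of I g])
    show "g \<in> I" "g \<noteq> 0" using \<theta> g by (simp_all add: I_def)
  qed (auto simp: I_def mp.diff mp.mult)
  then obtain q where q: "g = r * q" using \<open>P \<subseteq> I\<close> g(1) by (meson dvdE subsetD)
  then have "r \<in> P \<or> q \<in> P" using g(1) I_prime[of r q] by simp
  then have "r \<in> P"
  proof
    assume "q \<in> P"
    then have "degree g \<le> degree q"
      using g q by (intro dvd_imp_degree_le) auto
    then have "degree r = 0"
      using q g(2) by (auto simp: degree_mult_eq)
    then obtain c where "r = [:c:]" by (auto elim: degree_eq_zeroE)
    then have "r = 0" using r(1) by (auto simp: I_def map_poly_const)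
    then show ?thesis using r(2) by contradiction
  qed
  then have "I \<subseteq> P" using r(3) mult_closed by (metis dvdE mult.commute subsetI)
  then have "p \<in> P \<longleftrightarrow> poly (map_poly to_ac p) \<theta> = 0" for p
    using \<open>P \<subseteq> I\<close> by (auto simp: I_def)
  then show thesis by (rule that)
qed

lemma finite_range_evaluation:
  fixes \<theta> :: "'a::{field, finite} alg_closure"
  assumes "p \<noteq> 0" "poly (map_poly to_ac p) \<theta> = 0"
  shows "finite (range (\<lambda>q. poly (map_poly to_ac q) \<theta>))"
proof -
  interpret unital_ring_hom "to_ac :: 'a \<Rightarrow> _" by (rule to_ac_hom)
  have "finite {q :: 'a poly. degree q \<le> degree p}"
  proof (rule finite_subset)
    show "{q :: 'a poly. degree q \<le> degree p} \<subseteq> Poly ` {xs. set xs \<subseteq> UNIV \<and> length xs \<le> Suc (degree p)}"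
    proof
      fix q :: "'a poly" assume "q \<in> {q. degree q \<le> degree p}"
      then show "q \<in> Poly ` {xs. set xs \<subseteq> UNIV \<and> length xs \<le> Suc (degree p)}"
        by (intro image_eqI[of _ _ "coeffs q"])
          (cases "q = 0"; simp add: length_coeffs_degree)+
    qed
    show "finite (Poly ` {xs :: 'a list. set xs \<subseteq> UNIV \<and> length xs \<le> Suc (degree p)})"
      by (intro finite_imageI finite_lists_length_le) simp
  qed
  moreover have "range (\<lambda>q. poly (map_poly to_ac q) \<theta>) \<subseteq>
      (\<lambda>q. poly (map_poly to_ac q) \<theta>) ` {q. degree q \<le> degree p}"
  proof
    fix y assume "y \<in> range (\<lambda>q. poly (map_poly to_ac q) \<theta>)"
    then obtain q where q: "y = poly (map_poly to_ac q) \<theta>" by blast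
    have "map_poly to_ac q = map_poly to_ac (q div p) * map_poly to_ac p + map_poly to_ac (q mod p)"
      by (simp only: map_poly_mult[symmetric] map_poly_add[symmetric] div_mult_mod_eq)
    then have "y = poly (map_poly to_ac (q mod p)) \<theta>"
      using q assms(2) by simp
    moreover have "degree (q mod p) \<le> degree p"
      using degree_mod_less[OF assms(1), of q] by auto
    ultimately show "y \<in> (\<lambda>q. poly (map_poly to_ac q) \<theta>) ` {q. degree q \<le> degree p}" by blast
  qed
  ultimately show ?thesis
    using finite_surj by blast
qed

section \<open>Reducibility of \<open>Q\<^sub>n\<close> modulo every prime\<close>

lemma iterate_poly_conjugate:
  fixes f0 :: "'r::comm_ring_1 poly"
  assumes "f = pcompose f0 [:- g, 1:] + [:g:]"
  shows "iterate_poly f n = pcompose (iterate_poly f0 n) [:- g, 1:] + [:g:]"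
proof (induction n)
  case (Suc n)
  have "iterate_poly f (Suc n) = pcompose f0 (pcompose [:- g, 1:] (iterate_poly f n)) + [:g:]"
    by (simp add: iterate_poly_Suc assms pcompose_add pcompose_assoc)
  also have "pcompose [:- g, 1:] (iterate_poly f n) = pcompose (iterate_poly f0 n) [:- g, 1:]"
    by (simp add: Suc pcompose_pCons)
  finally show ?case by (simp add: iterate_poly_Suc pcompose_assoc)
qed (simp add: pcompose_pCons)

lemma map_poly_range_lift:
  fixes h :: "'r::comm_ring_1 \<Rightarrow> 's::comm_ring_1"
  assumes "unital_ring_hom h" "\<And>i. Polynomial.coeff p i \<in> range h"
  obtains q where "map_poly h q = p"
proof -
  interpret unital_ring_hom h by fact
  have "\<exists>q. map_poly h q = p"
    using assms(2)
  proof (induction p)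
    case (pCons a p)
    have "Polynomial.coeff p i \<in> range h" for i
      using pCons.prems[of "Suc i"] by simp
    then obtain q where "map_poly h q = p" using pCons.IH by blast
    moreover obtain b where "a = h b" using pCons.prems[of 0] by auto
    ultimately show ?case by (auto intro!: exI[of _ "pCons b q"] simp: map_poly_pCons')
  qed (auto intro: exI[of _ 0])
  then show thesis using that by blast
qed

text \<open>
  The condition on \<open>n\<close> makes the degree \<open>2^n\<close> divisible by four, which \<open>even_poly_splits\<close> needs.
  The factors found for \<open>Q\<^sub>n\<close> have coefficients in the image of \<open>ev\<close>, hence lift to \<open>k[t][x]\<close>,
  where the translation by \<open>\<gamma>\<close> turns them into factors of the iterate of \<open>f\<close> modulo \<open>P\<close>.
\<close>

lemma iterate_quadratic_reducible_mod_prime: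
  fixes m \<gamma> c :: "'a::{field, finite} poly"
  assumes two: "(2 :: 'a) \<noteq> 0" and n: "n \<ge> 2"
    and const: "poly (iterate_poly [:m, 0, 1:] n) 0 + \<gamma> = c ^ 2"
    and f: "f = pcompose [:m, 0, 1:] [:- \<gamma>, 1:] + [:\<gamma>:]"
    and P: "primeideal P (ring_of_type_algebra :: 'a poly ring)" "P \<noteq> {0}"
  shows "ring_reducible (UP (ring_of_type_algebra Quot P)) (reduce_poly P (iterate_poly f n))"
proof -
  obtain \<theta> :: "'a alg_closure" where \<theta>: "\<And>p. p \<in> P \<longleftrightarrow> poly (map_poly to_ac p) \<theta> = 0"
    using prime_ideal_kernel_of_evaluation[OF P] by metis
  define ev where "ev p = poly (map_poly to_ac p) \<theta>" for p :: "'a poly"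
  interpret ac: unital_ring_hom "to_ac :: 'a \<Rightarrow> _" by (rule to_ac_hom)
  interpret ev: unital_ring_hom ev
    by unfold_locales (simp_all add: ev_def ac.map_poly_add ac.map_poly_mult)
  interpret prime_quotient P ev
    by (intro prime_quotient.intro P(1) ev.unital_ring_hom_axioms) (simp add: ev_def \<theta>)
  obtain p where "p \<in> P" "p \<noteq> 0"
    using P(2) additive_subgroup.zero_closed[OF additive_subgroup_axioms] by auto
  interpret K: finite_subring_of_field "range ev"
  proof
    show "finite (range ev)"
      using finite_range_evaluation[OF \<open>p \<noteq> 0\<close>] \<theta> \<open>p \<in> P\<close> unfolding ev_def by blast
    show "0 \<in> range ev" "1 \<in> range ev"
      using ev.zero ev.one by (metis rangeI)+
    fix x y assume "x \<in> range ev" "y \<in> range ev"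
    then show "x + y \<in> range ev" "x * y \<in> range ev"
      by (auto simp: ev.add[symmetric] ev.mult[symmetric])
  qed
  define \<phi> where "\<phi> x = x ^ card (range ev)" for x :: "'a alg_closure"
  interpret \<phi>: unital_ring_hom \<phi>
    unfolding \<phi>_def by (rule K.frobenius_hom)
  have fixed_iff: "\<phi> x = x \<longleftrightarrow> x \<in> range ev" for x
    unfolding \<phi>_def by (rule K.frobenius_fixed_iff)
  have poly_fixed_iff: "map_poly \<phi> q = q \<longleftrightarrow> (\<forall>i. Polynomial.coeff q i \<in> range ev)" for q
    by (simp add: poly_eq_iff coeff_map_poly fixed_iff)
  define Q where "Q = iterate_poly [:m, 0, 1:] n + [:\<gamma>:]"
  define G where "G = map_poly ev Q"
  have G: "G = iterate_poly [:ev m, 0, 1:] n + [:ev \<gamma>:]"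
    by (simp add: G_def Q_def ev.map_poly_add ev.map_poly_iterate_poly ev.map_poly_pCons' ev.one)
  obtain k where k: "n = Suc (Suc k)" using n by (metis add_2_eq_Suc le_Suc_ex)
  have "\<exists>A B. G = A * B \<and> map_poly \<phi> A = A \<and> map_poly \<phi> B = B \<and> degree A > 0 \<and> degree B > 0"
  proof (rule even_poly_splits)
    show "unital_ring_hom \<phi>" by unfold_locales
    show "map_poly \<phi> G = G"
      by (simp add: poly_fixed_iff G_def coeff_map_poly)
    show "lead_coeff G = 1"
      unfolding G by (rule lead_coeff_iterate_quadratic_plus)
    show "degree G = 2 * 2 ^ Suc k"
      unfolding G degree_iterate_quadratic_plus by (simp add: k)
    show "poly G (- x) = poly G x" for x
      unfolding G k iterate_quadratic_plus_Suc by (simp add: poly_pcompose)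
    show "poly G 0 = ev c ^ 2"
      using ev.poly_map_poly[of Q 0] const by (simp add: G_def Q_def ev.power[symmetric])
    show "\<phi> (ev c) = ev c" by (simp add: fixed_iff)
    show "(2 :: 'a alg_closure) \<noteq> 0"
      using two to_ac_eq_0_iff[of "2 :: 'a"] by simp
  qed simp_all
  then obtain A B where AB: "G = A * B" "map_poly \<phi> A = A" "map_poly \<phi> B = B" "degree A > 0" "degree B > 0"
    by blast
  obtain A' where A': "map_poly ev A' = A"
    using map_poly_range_lift[OF ev_hom] AB(2) unfolding poly_fixed_iff by blast
  obtain B' where B': "map_poly ev B' = B"
    using map_poly_range_lift[OF ev_hom] AB(3) unfolding poly_fixed_iff by blast
  define s where "s = [:- \<gamma>, 1:]"
  have "iterate_poly f n = pcompose Q s"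
    using iterate_poly_conjugate[OF f, of n] by (simp add: Q_def s_def pcompose_add)
  then have eq: "map_poly ev (iterate_poly f n) = map_poly ev (pcompose A' s) * map_poly ev (pcompose B' s)"
    using AB(1) by (simp add: ev.map_poly_pcompose A' B' G_def pcompose_mult)
  have deg: "degree (map_poly ev (pcompose q s)) = degree (map_poly ev q)" for q
    by (simp add: ev.map_poly_pcompose s_def ev.map_poly_pCons' ev.one degree_pcompose)
  show ?thesis
    by (rule ring_reducible_reduce_poly[OF eq]) (simp_all only: deg A' B' AB(4,5))
qed

theorem theorem1p4:
  fixes m \<gamma> :: "'a::{field, finite} poly"
    and f0 f :: "'a poly poly"
    and n :: nat
  assumes "odd CHAR('a)"
    and "n \<ge> 3"
    and "odd (degree m)"
    and "f0 = [:0, 1:] ^ 2 + [:m:]"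
    and "\<gamma> = m ^ (2 ^ (n - 1)) - poly (iterate_poly f0 n) 0"
    and "f = ([:0, 1:] - [:\<gamma>:]) ^ 2 + [:\<gamma>:] + [:m:]"
  shows "Factorial_Ring.irreducible (fract_poly (iterate_poly f n)) \<and>
    (\<forall>P. primeideal P (ring_of_type_algebra :: 'a poly ring) \<and> P \<noteq> {0} \<longrightarrow>
      ring_reducible (UP (ring_of_type_algebra Quot P)) (reduce_poly P (iterate_poly f n)))"
proof -
  have two: "(2 :: 'a) \<noteq> 0"
  proof
    assume "(2 :: 'a) = 0"
    then have "CHAR('a) dvd 2"
      using of_nat_eq_0_iff_char_dvd[where 'a = 'a, of 2] by simp
    then have "CHAR('a) = 1"
      using assms(1) by (metis prime_nat_iff two_is_prime_nat)
    then show False using CHAR_not_1' by auto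
  qed
  have f0: "f0 = [:m, 0, 1:]"
    by (simp add: assms(4) power2_eq_square)
  have f: "f = pcompose [:m, 0, 1:] [:- \<gamma>, 1:] + [:\<gamma>:]"
    by (simp add: assms(6) pcompose_pCons power2_eq_square)
  interpret F: unital_ring_hom "to_fract :: 'a poly \<Rightarrow> _"
    by unfold_locales simp_all
  have "iterate_poly f n = pcompose (iterate_poly [:m, 0, 1:] n + [:\<gamma>:]) [:- \<gamma>, 1:]"
    by (simp add: iterate_poly_conjugate[OF f] pcompose_add)
  then have "fract_poly (iterate_poly f n) =
      pcompose (fract_poly (iterate_poly [:m, 0, 1:] n + [:\<gamma>:])) [:- to_fract \<gamma>, 1:]"
    by (simp only: F.map_poly_pcompose F.map_poly_pCons' F.uminus F.one F.zero map_poly_0)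
  then have "Factorial_Ring.irreducible (fract_poly (iterate_poly f n))"
    using iterate_quadratic_irreducible_fract[OF two assms(2,3) assms(5)[unfolded f0]]
    by (simp only: irreducible_pcompose_shift)
  moreover have "ring_reducible (UP (ring_of_type_algebra Quot P)) (reduce_poly P (iterate_poly f n))"
    if P: "primeideal P (ring_of_type_algebra :: 'a poly ring)" "P \<noteq> {0}" for P
  proof (rule iterate_quadratic_reducible_mod_prime[OF two _ _ f P])
    show "n \<ge> 2" using assms(2) by simp
    have "2 ^ (n - 1) = 2 ^ (n - 2) * (2 :: nat)"
      using assms(2) power_Suc2[of "2::nat" "n - 2"] by (simp add: Suc_diff_Suc numeral_2_eq_2)
    then show "poly (iterate_poly [:m, 0, 1:] n) 0 + \<gamma> = (m ^ 2 ^ (n - 2)) ^ 2"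
      using assms(5) by (simp add: f0 power_mult)
  qed
  ultimately show ?thesis by blast
qed

end
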